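(* Let $n\ge 1$ be an integer, let $Q_n(\boldsymbol v)=\sum_{j=1}^{n+1}v_j^2-v_{n+2}^2$, let $G=\operatorname{SO}_{Q_n}^+(\mathbb R)$ and $\Gamma=\operatorname{SO}_{Q_n}^+(\mathbb Z)$, and let $P_1,\dots,P_\kappa$ be a full set of representatives of the cusps of $\Gamma$. Then for every cusp $P_i$ ($1\le i\le\kappa$) the cusp volume $v_{P_i}=\mu_L(g_i^{-1}\Gamma_{P_i}g_i\backslash L)$ is a rational number.
   Context: Vectors in $\mathbb R^{n+2}$ are row vectors and matrices act on them from the right. $G=\operatorname{SO}_{Q_n}^+(\mathbb R)$ is the connected component of the identity of the special orthogonal group of $Q_n$; equivalently, it consists of the real matrices of determinant $1$ that preserve $Q_n$ and preserve each sheet of the light-cone. $\Gamma=\operatorname{SO}_{Q_n}^+(\mathbb Z)$ is the subgroup of matrices in $G$ with integer entries. Put $$\mathcal V_{Q_n}=\{\boldsymbol v\in\mathbb R^{n+2}\setminus\{0\}:Q_n(\boldsymbol v)=0\},\qquad \mathcal V_{Q_n}^+=\{\boldsymbol v\in\mathcal V_{Q_n}: v_{n+2}>0\},$$ and let $\mathcal V_{Q_n}^+(\mathbb Z)_{\mathrm{pr}}$ be the set of primitive integer vectors in $\mathcal V_{Q_n}^+$ (entries with greatest common divisor $1$). Fix $\boldsymbol e_0=(-1,0,\dots,0,1)\in\mathcal V_{Q_n}^+$. The subgroup $P\subset G$ stabilising the line spanned by $\boldsymbol e_0$ is parabolic, with Langlands decomposition $P=UAM$, where $A$ is one-dimensional,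 $M\cong\operatorname{SO}_n(\mathbb R)$ is the group of block-diagonal matrices $\operatorname{diag}(1,m,1)$ with $m\in\operatorname{SO}_n(\mathbb R)$, and $U=\{u_x:x\in\mathbb R^n\}\cong\mathbb R^n$ with $$u_x=\begin{pmatrix}1-\frac{\|x\|^2}{2} & x & \frac{\|x\|^2}{2}\\ -x^t & I_n & x^t\\ -\frac{\|x\|^2}{2} & x & 1+\frac{\|x\|^2}{2}\end{pmatrix}.$$ $L=UM$ is the stabiliser of $\boldsymbol e_0$ in $G$. Its Haar measure is normalised by $d\mu_L(u_xm)=d\boldsymbol x\,d\mu_M(m)$, where $d\boldsymbol x$ is Lebesgue measure on $\mathbb R^n$ and $\mu_M$ is the probability Haar measure on $M$. For a ray $[\boldsymbol v]\subset\mathcal V_{Q_n}^+$, let $P_{[\boldsymbol v]}$ be the unique (proper) parabolic subgroup of $G$ fixing $[\boldsymbol v]$. For a parabolic subgroup $P_i$ of $G$ with unipotent radical $U_i$, write $\Gamma_{P_i}=\Gamma\cap P_i$ and $\Gamma_{U_i}=\Gamma\cap U_i$. The cusps of $\Gamma$ are the $\Gamma$-conjugacy classes of parabolic subgroups $P_i$ of $G$ such that $\Gamma_{U_i}$ is non-trivial. They correspond bijectively to the $\Gamma$-orbits on $\mathcal V_{Q_n}^+(\mathbb Z)_{\mathrm{pr}}$: there are $\boldsymbol v_1,\dots,\boldsymbol v_\kappa\in\mathcal V_{Q_n}^+(\mathbb Z)_{\mathrm{pr}}$ with $\mathcal V_{Q_n}^+(\mathbb Z)_{\mathrm{pr}}=\bigsqcup_{i=1}^\kappa\boldsymbol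 v_i\Gamma$, and $P_i=P_{[\boldsymbol v_i]}$. For each $i$ choose $g_i\in G$ with $\boldsymbol v_i=\boldsymbol e_0g_i^{-1}$. Then $g_i^{-1}P_ig_i=P$ and $g_i^{-1}\Gamma_{P_i}g_i$ is a subgroup of $L$. The cusp volume is $v_{P_i}=\mu_L(g_i^{-1}\Gamma_{P_i}g_i\backslash L)$, the $\mu_L$-measure of a fundamental domain for $g_i^{-1}\Gamma_{P_i}g_i$ acting on $L$; it is independent of the choice of $g_i$ and of the representative $\boldsymbol v_i$ of its $\Gamma$-orbit. *)

theory Defs
  imports "HOL-Probability.Probability" "HOL-Algebra.Coset"
begin

(* The n + 2 coordinates of the ambient space: 'n indexes the n middle ones, so n = CARD('n) >= 1,
   and Front / Back are the first and the last coordinate. *)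
datatype 'n idx = Front | Mid 'n | Back

lemma UNIV_idx: "(UNIV :: 'n idx set) = insert Front (insert Back (range Mid))"
  by (auto intro: idx.exhaust)

instance idx :: (finite) finite
  by standard (simp add: UNIV_idx)

type_synonym 'n vec2 = "real ^ 'n idx"
type_synonym 'n mat2 = "real ^ 'n idx ^ 'n idx"

definition quadQ :: "('n::finite) vec2 \<Rightarrow> real" where
  "quadQ v = (\<Sum>j\<in>UNIV - {Back}. (v $ j)\<^sup>2) - (v $ Back)\<^sup>2"

definition SOQ :: "('n::finite) mat2 set" where
  "SOQ = {h. det h = 1 \<and> (\<forall>v. quadQ (v v* h) = quadQ v)}"

definition SOQ_plus :: "('n::finite) mat2 set" where
  "SOQ_plus = connected_component_set SOQ (mat 1)"

definition SOQ_plus_int :: "('n::finite) mat2 set" where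
  "SOQ_plus_int = {h \<in> SOQ_plus. \<forall>i j. h $ i $ j \<in> \<int>}"

definition cone_plus :: "('n::finite) vec2 set" where
  "cone_plus = {v. v \<noteq> 0 \<and> quadQ v = 0 \<and> v $ Back > 0}"

definition primitive_cone_plus :: "('n::finite) vec2 set" where
  "primitive_cone_plus =
     {v \<in> cone_plus. \<exists>w :: int ^ 'n idx. v = (\<chi> j. of_int (w $ j)) \<and> Gcd (range (($) w)) = 1}"

definition e0 :: "('n::finite) vec2" where
  "e0 = (\<chi> j. case j of Front \<Rightarrow> -1 | Mid _ \<Rightarrow> 0 | Back \<Rightarrow> 1)"

definition unip :: "real ^ 'n \<Rightarrow> ('n::finite) mat2" where
  "unip x = (\<chi> i j.
     case i of
       Front \<Rightarrow> (case j of Front \<Rightarrow> 1 - (norm x)\<^sup>2 / 2 | Mid b \<Rightarrow> x $ b | Back \<Rightarrow> (norm x)\<^sup>2 / 2)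
     | Mid a \<Rightarrow> (case j of Front \<Rightarrow> - (x $ a) | Mid b \<Rightarrow> (if a = b then 1 else 0) | Back \<Rightarrow> x $ a)
     | Back \<Rightarrow> (case j of Front \<Rightarrow> - ((norm x)\<^sup>2 / 2) | Mid b \<Rightarrow> x $ b | Back \<Rightarrow> 1 + (norm x)\<^sup>2 / 2))"

definition block_diag :: "real ^ 'n ^ 'n \<Rightarrow> ('n::finite) mat2" where
  "block_diag m = (\<chi> i j.
     case i of
       Mid a \<Rightarrow> (case j of Mid b \<Rightarrow> m $ a $ b | _ \<Rightarrow> 0)
     | _ \<Rightarrow> (if i = j then 1 else 0))"

definition grpM :: "('n::finite) mat2 set" where
  "grpM = block_diag ` {m. rotation_matrix m}"

definition grpL :: "('n::finite) mat2 set" where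
  "grpL = {unip x ** k | x k. k \<in> grpM}"

(* The group K is compact in the application, so left and right invariance are equivalent and the
   measure is unique. *)
definition haar_probability :: "('n::finite) mat2 set \<Rightarrow> 'n mat2 measure \<Rightarrow> bool" where
  "haar_probability K \<mu> \<longleftrightarrow>
     prob_space \<mu> \<and> space \<mu> = K \<and> sets \<mu> = sets (restrict_space borel K) \<and>
     (\<forall>k\<in>K. distr \<mu> \<mu> (\<lambda>h. k ** h) = \<mu>)"

(* d mu_L (u_x m) = dx d mu_M(m) *)
definition haar_L :: "('n::finite) mat2 measure \<Rightarrow> 'n mat2 measure" where
  "haar_L \<mu>M =
     distr (lborel \<Otimes>\<^sub>M \<mu>M) (restrict_space borel grpL) (\<lambda>(x, k). unip x ** k)"

definition ray :: "('n::finite) vec2 \<Rightarrow> 'n vec2 set" where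
  "ray v = {c *\<^sub>R v | c. c > 0}"

definition parabolic_of :: "('n::finite) vec2 \<Rightarrow> 'n mat2 set" where
  "parabolic_of v = {h \<in> SOQ_plus. (\<lambda>w. w v* h) ` ray v = ray v}"

(* The proper parabolic subgroups of this real rank one group are the stabilisers of the rays of
   the light-cone. *)
definition proper_parabolic :: "('n::finite) mat2 set \<Rightarrow> bool" where
  "proper_parabolic P \<longleftrightarrow> (\<exists>v\<in>cone_plus. P = parabolic_of v)"

definition unipotent :: "('n::finite) mat2 \<Rightarrow> bool" where
  "unipotent h \<longleftrightarrow> (\<exists>k::nat. ((\<lambda>B. B ** (h - mat 1)) ^^ k) (mat 1) = 0)"

definition matrix_group :: "('n::finite) mat2 set \<Rightarrow> 'n mat2 monoid" where
  "matrix_group H = \<lparr>carrier = H, monoid.mult = (**), one = mat 1\<rparr>"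

(* The union of all connected normal unipotent subgroups; for a parabolic subgroup it is itself the
   largest such subgroup. *)
definition unipotent_radical :: "('n::finite) mat2 set \<Rightarrow> 'n mat2 set" where
  "unipotent_radical H =
     \<Union>{N. N \<lhd> matrix_group H \<and> connected N \<and> (\<forall>h\<in>N. unipotent h)}"

definition cuspidal :: "('n::finite) mat2 set \<Rightarrow> bool" where
  "cuspidal P \<longleftrightarrow> proper_parabolic P \<and> SOQ_plus_int \<inter> unipotent_radical P \<noteq> {mat 1}"

(* g^{-1} S g *)
definition conjugate :: "('n::finite) mat2 \<Rightarrow> 'n mat2 set \<Rightarrow> 'n mat2 set" where
  "conjugate g S = (\<lambda>h. matrix_inv g ** h ** g) ` S"

definition conj_class :: "('n::finite) mat2 set \<Rightarrow> 'n mat2 set set" where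
  "conj_class P = {conjugate \<gamma> P | \<gamma>. \<gamma> \<in> SOQ_plus_int}"

definition cusps :: "('n::finite) mat2 set set set" where
  "cusps = conj_class ` {P. cuspidal P}"

(* D is a Borel set containing exactly one point of each orbit H l of the action by left
   multiplication. *)
definition fundamental_domain ::
  "('n::finite) mat2 measure \<Rightarrow> 'n mat2 set \<Rightarrow> 'n mat2 set \<Rightarrow> bool" where
  "fundamental_domain \<mu> H D \<longleftrightarrow>
     D \<in> sets \<mu> \<and> (\<forall>l\<in>space \<mu>. \<exists>!d. d \<in> D \<and> (\<exists>h\<in>H. d = h ** l))"

(* The measure of H \ (space mu): the common measure of all fundamental domains. *)
definition covolume :: "('n::finite) mat2 measure \<Rightarrow> 'n mat2 set \<Rightarrow> ennreal" where
  "covolume \<mu> H = (THE c. \<exists>D. fundamental_domain \<mu> H D \<and> c = emeasure \<mu> D)"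

definition cusp_volume ::
  "('n::finite) mat2 measure \<Rightarrow> 'n mat2 set \<Rightarrow> 'n mat2 \<Rightarrow> ennreal" where
  "cusp_volume \<mu>M P g = covolume (haar_L \<mu>M) (conjugate g (SOQ_plus_int \<inter> P))"

end

theory Submission
  imports Defs
begin

text \<open>
Fix a cusp, given by a primitive integral vector \<open>v = e0 g\<^sup>-\<^sup>1\<close> of the light-cone, and let \<open>H\<close> be the group
\<open>g\<^sup>-\<^sup>1 \<Gamma>\<^sub>P g\<close>. Elements of \<open>\<Gamma>\<^sub>P\<close> fix not only the ray of \<open>v\<close> but \<open>v\<close> itself, because \<open>v\<close> is primitive
(\<open>integral_parabolic_fixes_vector\<close>). Hence \<open>H\<close> fixes \<open>e0\<close> and lies in \<open>L = UM\<close>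
(\<open>stabilizer_e0_subset_grpL\<close>), and it is discrete since it is conjugate to a group of integral matrices.

The covolume of \<open>H\<close> is compared with that of a subgroup \<open>K\<close> of translations. For a group acting freely
and measure-preservingly, all fundamental domains have the same measure, and the covolume of a subgroup is
the index times the covolume of the group (\<open>covolume_subgroup\<close>). So the covolume of \<open>H\<close> is rational as
soon as that of \<open>K\<close> is (\<open>covolume_rational\<close>). A fundamental domain for \<open>H\<close> exists because \<open>H\<close> is discrete
(\<open>fundamental_domain_exists\<close>), and the measure on \<open>L\<close> is left invariant because Lebesgue measure is
invariant under Euclidean motions (\<open>haar_L_invariant\<close>).

The arithmetic input is that \<open>K\<close> can be taken to be an isometric copy of the cubic lattice \<open>N \<int>\<^sup>n\<close>, of covolume
\<open>N\<^sup>n\<close> (\<open>cusp_contains_cubic_lattice\<close>). A rational isometry \<open>r\<close>, a reflection or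
the identity, takes \<open>v\<close> to a rational multiple of \<open>e0\<close>
(\<open>rational_reflection\<close>). Through \<open>r\<close> the space \<open>v\<^sup>\<bottom>/v\<close> becomes, rationally and isometrically, the
standard Euclidean space; in particular its lattice of integral vectors is commensurable with a cubic one,
so that no square roots enter its covolume. The elements of \<open>g U g\<^sup>-\<^sup>1\<close> are the Eichler transvections attached
to vectors of \<open>v\<^sup>\<bottom>/v\<close> (\<open>conjugate_unip_action\<close>), and such a transvection is an integral matrix whenever
the vector has an integral representative of even norm.
\<close>

section \<open>The bilinear form and its isometries\<close>

lemma sum_idx:
  fixes f :: "'n::finite idx \<Rightarrow> 'a::comm_monoid_add"
  shows "(\<Sum>i\<in>UNIV. f i) = f Front + (f Back + (\<Sum>a\<in>UNIV. f (Mid a)))"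
proof -
  have "inj (Mid :: 'n \<Rightarrow> 'n idx)" by (auto intro: injI)
  then have "(\<Sum>i\<in>range Mid. f i) = (\<Sum>a\<in>UNIV. f (Mid a))"
    by (simp add: sum.reindex)
  moreover have "Front \<notin> insert Back (range (Mid :: 'n \<Rightarrow> 'n idx))" "Back \<notin> range (Mid :: 'n \<Rightarrow> 'n idx)" by auto
  ultimately show ?thesis by (simp add: UNIV_idx)
qed

lemma prod_idx:
  fixes f :: "'n::finite idx \<Rightarrow> 'a::comm_monoid_mult"
  shows "(\<Prod>i\<in>UNIV. f i) = f Front * (f Back * (\<Prod>a\<in>UNIV. f (Mid a)))"
proof -
  have "inj (Mid :: 'n \<Rightarrow> 'n idx)" by (auto intro: injI)
  then have "(\<Prod>i\<in>range Mid. f i) = (\<Prod>a\<in>UNIV. f (Mid a))"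
    by (simp add: prod.reindex)
  moreover have "Front \<notin> insert Back (range (Mid :: 'n \<Rightarrow> 'n idx))" "Back \<notin> range (Mid :: 'n \<Rightarrow> 'n idx)" by auto
  ultimately show ?thesis by (simp add: UNIV_idx)
qed

definition signature :: "'n idx \<Rightarrow> real" where
  "signature i = (if i = Back then -1 else 1)"

lemma signature_simps [simp]:
  "signature Front = 1" "signature (Mid a) = 1" "signature Back = -1"
  "signature i * signature i = 1"
  by (auto simp: signature_def)

text \<open>
This is the symmetric bilinear form polarising \<open>quadQ\<close>. Everything below is phrased with it, since
a linear map preserves \<open>quadQ\<close> if and only if it preserves \<open>form\<close>, and then its inverse is its adjoint.
\<close>

definition form :: "('n::finite) vec2 \<Rightarrow> 'n vec2 \<Rightarrow> real" where
  "form u w = (\<Sum>i\<in>UNIV. signature i * (u $ i * w $ i))"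

lemma form_split:
  "form u w = u $ Front * w $ Front + (\<Sum>a\<in>UNIV. u $ Mid a * w $ Mid a) - u $ Back * w $ Back"
  by (simp add: form_def sum_idx)

lemma quadQ_form: "quadQ u = form u u"
proof -
  have "(\<Sum>j\<in>UNIV. (u $ j)\<^sup>2) = (u $ Back)\<^sup>2 + (\<Sum>j\<in>UNIV - {Back}. (u $ j)\<^sup>2)"
    by (simp add: sum.remove)
  then show ?thesis
    unfolding quadQ_def form_split by (simp add: sum_idx power2_eq_square)
qed

lemma form_commute: "form u w = form w u"
  by (simp add: form_def mult.commute)

lemma form_add_left: "form (u + u') w = form u w + form u' w"
  by (simp add: form_def algebra_simps sum.distrib)

lemma form_diff_left: "form (u - u') w = form u w - form u' w"
  by (simp add: form_def algebra_simps sum_subtractf)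

lemma form_scaleR_left: "form (c *\<^sub>R u) w = c * form u w"
  by (simp add: form_def sum_distrib_left algebra_simps)

lemma form_add_right: "form w (u + u') = form w u + form w u'"
  by (simp add: form_commute[of w] form_add_left)

lemma form_diff_right: "form w (u - u') = form w u - form w u'"
  by (simp add: form_commute[of w] form_diff_left)

lemma form_scaleR_right: "form w (c *\<^sub>R u) = c * form w u"
  by (simp add: form_commute[of w] form_scaleR_left)

lemmas form_linear = form_add_left form_diff_left form_scaleR_left
  form_add_right form_diff_right form_scaleR_right

lemma form_axis: "form u (axis i 1) = signature i * u $ i"
  by (simp add: form_def axis_def if_distrib cong: if_cong)

lemma axis_vector_matrix: "axis i 1 v* (h :: ('n::finite) mat2) = h $ i"
  by (simp add: vector_matrix_mult_def axis_def vec_eq_iff if_distrib if_distribR cong: if_cong)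

definition form_preserving :: "('n::finite) mat2 \<Rightarrow> bool" where
  "form_preserving h \<longleftrightarrow> (\<forall>u w. form (u v* h) (w v* h) = form u w)"

lemma form_preservingD: "form_preserving h \<Longrightarrow> form (u v* h) (w v* h) = form u w"
  by (simp add: form_preserving_def)

lemma SOQ_iff: "h \<in> SOQ \<longleftrightarrow> det h = 1 \<and> form_preserving h"
proof -
  have "form (u v* h) (w v* h) = form u w" if "\<forall>u. quadQ (u v* h) = quadQ u" for u w
  proof -
    have polarize: "2 * form x y = quadQ (x + y) - quadQ x - quadQ y" for x y :: "'a vec2"
      using form_commute[of x y] by (simp add: quadQ_form form_linear)
    have "2 * form (u v* h) (w v* h) = 2 * form u w"
      unfolding polarize using that by (simp flip: vector_matrix_left_distrib)
    then show ?thesis by simp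
  qed
  then show ?thesis
    by (auto simp: SOQ_def form_preserving_def quadQ_form)
qed

lemma form_preserving_mat_1: "form_preserving (mat 1)"
  by (simp add: form_preserving_def)

lemma form_preserving_mult:
  "form_preserving h \<Longrightarrow> form_preserving k \<Longrightarrow> form_preserving (h ** k)"
  by (simp add: form_preserving_def vector_matrix_mul_assoc[symmetric])

text \<open>
The adjoint of \<open>h\<close> for \<open>form\<close>. It makes the inverse of a \<open>form\<close>-preserving matrix explicit: its entries
are, up to sign, entries of \<open>h\<close>. Hence inversion is continuous and keeps entries integral.
\<close>

definition form_adjoint :: "('n::finite) mat2 \<Rightarrow> 'n mat2" where
  "form_adjoint h = (\<chi> i j. signature i * signature j * h $ j $ i)"

lemma form_adjoint_inverse:
  assumes "form_preserving h"
  shows "h ** form_adjoint h = mat 1" "form_adjoint h ** h = mat 1"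
proof -
  have "(h ** form_adjoint h) $ i $ j = mat 1 $ i $ j" for i j
  proof -
    have "(h ** form_adjoint h) $ i $ j = signature j * form (h $ i) (h $ j)"
      by (simp add: matrix_matrix_mult_def form_adjoint_def form_def sum_distrib_left mult_ac)
    also have "form (h $ i) (h $ j) = form (axis i 1) (axis j 1)"
      using form_preservingD[OF assms, of "axis i 1" "axis j 1"] by (simp add: axis_vector_matrix)
    also have "signature j * \<dots> = mat 1 $ i $ j"
      by (simp only: form_axis) (simp add: mat_def axis_def signature_def)
    finally show ?thesis .
  qed
  then show "h ** form_adjoint h = mat 1"
    by (simp add: vec_eq_iff)
  then show "form_adjoint h ** h = mat 1"
    by (simp add: matrix_left_right_inverse)
qed

lemma matrix_inv_eqI:
  fixes h k :: "real ^ 'm ^ 'm::finite"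
  assumes "h ** k = mat 1"
  shows "matrix_inv h = k"
proof -
  have kh: "k ** h = mat 1" using assms by (simp add: matrix_left_right_inverse)
  have "h ** matrix_inv h = mat 1 \<and> matrix_inv h ** h = mat 1"
    unfolding matrix_inv_def by (rule someI[of _ k]) (use assms kh in blast)
  then have "matrix_inv h ** (h ** k) = k" by (simp add: matrix_mul_assoc)
  then show ?thesis using assms by simp
qed

lemma form_preserving_inv:
  assumes "form_preserving h"
  shows "matrix_inv h = form_adjoint h" "h ** matrix_inv h = mat 1" "matrix_inv h ** h = mat 1"
    "form_preserving (matrix_inv h)"
proof -
  show inv: "matrix_inv h = form_adjoint h"
    using form_adjoint_inverse[OF assms] by (intro matrix_inv_eqI) 
  show "h ** matrix_inv h = mat 1" "matrix_inv h ** h = mat 1"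
    by (simp_all add: inv form_adjoint_inverse[OF assms])
  then have "form (u v* matrix_inv h) (w v* matrix_inv h) = form u w" for u w
    using form_preservingD[OF assms, of "u v* matrix_inv h" "w v* matrix_inv h"]
    by (simp add: vector_matrix_mul_assoc)
  then show "form_preserving (matrix_inv h)" by (simp add: form_preserving_def)
qed

lemma SOQ_mat_1: "mat 1 \<in> SOQ"
  by (simp add: SOQ_iff form_preserving_mat_1)

lemma SOQ_mult: "h \<in> SOQ \<Longrightarrow> k \<in> SOQ \<Longrightarrow> h ** k \<in> SOQ"
  by (simp add: SOQ_iff form_preserving_mult det_mul)

lemma SOQ_inv: "h \<in> SOQ \<Longrightarrow> matrix_inv h \<in> SOQ"
proof -
  assume h: "h \<in> SOQ"
  then have "h ** matrix_inv h = mat 1" using form_preserving_inv(2) SOQ_iff by blast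
  then have "det h * det (matrix_inv h) = 1" by (metis det_I det_mul)
  moreover have "form_preserving (matrix_inv h)"
    using h form_preserving_inv(4) SOQ_iff by blast
  ultimately show ?thesis using h by (simp add: SOQ_iff)
qed

lemma continuous_on_matrix_mult [continuous_intros]:
  fixes f :: "'a::topological_space \<Rightarrow> real ^ 'm::finite ^ 'l::finite"
    and g :: "'a \<Rightarrow> real ^ 'n::finite ^ 'm"
  assumes "continuous_on S f" "continuous_on S g"
  shows "continuous_on S (\<lambda>x. f x ** g x)"
  unfolding matrix_matrix_mult_def
  by (intro continuous_intros assms)

lemma continuous_on_form_adjoint [continuous_intros]:
  assumes "continuous_on S f"
  shows "continuous_on S (\<lambda>x. form_adjoint (f x))"
  unfolding form_adjoint_def by (intro continuous_intros assms)

text \<open>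
Left translation by an element of \<open>SOQ\<close> is a homeomorphism of \<open>SOQ\<close>, so it maps connected components
to connected components. Applied to the component of the identity this makes \<open>SOQ_plus\<close> a group.
\<close>

lemma connected_component_SOQ_mult:
  assumes "k \<in> SOQ" "connected_component SOQ h h'"
  shows "connected_component SOQ (k ** h) (k ** h')"
proof -
  from assms(2) obtain T where T: "connected T" "T \<subseteq> SOQ" "h \<in> T" "h' \<in> T"
    by (auto simp: connected_component_def)
  have "connected ((**) k ` T)"
    by (intro connected_continuous_image T continuous_intros)
  moreover have "(**) k ` T \<subseteq> SOQ" using T assms by (auto intro: SOQ_mult)
  ultimately show ?thesis using T unfolding connected_component_def by blast
qed

lemma SOQ_plus_SOQ: "h \<in> SOQ_plus \<Longrightarrow> h \<in> SOQ"
  using connected_component_subset unfolding SOQ_plus_def by blast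

lemma SOQ_plus_mat_1: "mat 1 \<in> SOQ_plus"
  by (simp add: SOQ_plus_def SOQ_mat_1)

lemma SOQ_plus_mult: 
  assumes "h \<in> SOQ_plus" "k \<in> SOQ_plus" shows "h ** k \<in> SOQ_plus"
proof -
  have "connected_component SOQ (h ** mat 1) (h ** k)"
    using assms by (intro connected_component_SOQ_mult SOQ_plus_SOQ) (auto simp: SOQ_plus_def)
  with assms show ?thesis
    by (auto simp: SOQ_plus_def intro: connected_component_trans)
qed

lemma SOQ_plus_inv: 
  assumes "h \<in> SOQ_plus" shows "matrix_inv h \<in> SOQ_plus"
proof -
  have "connected_component SOQ (matrix_inv h ** mat 1) (matrix_inv h ** h)"
    using assms by (intro connected_component_SOQ_mult SOQ_inv SOQ_plus_SOQ) (auto simp: SOQ_plus_def)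
  moreover have "matrix_inv h ** h = mat 1"
    using SOQ_plus_SOQ[OF assms] form_preserving_inv(3) SOQ_iff by blast
  ultimately show ?thesis
    by (auto simp: SOQ_plus_def connected_component_sym_eq)
qed

lemma SOQ_plus_int_mult: 
  assumes "h \<in> SOQ_plus_int" "k \<in> SOQ_plus_int" shows "h ** k \<in> SOQ_plus_int"
  using assms SOQ_plus_mult by (auto simp: SOQ_plus_int_def matrix_matrix_mult_def)

lemma SOQ_plus_int_inv: 
  assumes "h \<in> SOQ_plus_int" shows "matrix_inv h \<in> SOQ_plus_int"
proof -
  have "form_preserving h" using assms SOQ_plus_SOQ by (auto simp: SOQ_plus_int_def SOQ_iff)
  then have "matrix_inv h = form_adjoint h" by (rule form_preserving_inv)
  moreover have "form_adjoint h $ i $ j \<in> \<int>" for i j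
    using assms by (auto simp: SOQ_plus_int_def form_adjoint_def signature_def)
  moreover have "matrix_inv h \<in> SOQ_plus"
    using assms SOQ_plus_inv by (auto simp: SOQ_plus_int_def)
  ultimately show ?thesis by (simp add: SOQ_plus_int_def)
qed

lemma mat_component: "mat c $ i $ j = (if i = j then c else 0)"
  by (simp add: mat_def)

lemma SOQ_plus_int_mat_1: "mat 1 \<in> SOQ_plus_int"
  unfolding SOQ_plus_int_def using SOQ_plus_mat_1 by (simp add: mat_component)

section \<open>The group L = UM as the stabiliser of the isotropic vector e0\<close>

lemma vec_idx_eqI:
  fixes u w :: "'a ^ ('n::finite) idx"
  assumes "u $ Front = w $ Front" "u $ Back = w $ Back" "\<And>a. u $ Mid a = w $ Mid a"
  shows "u = w"
proof -
  have "u $ i = w $ i" for i using assms by (cases i) auto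
  then show ?thesis by (simp add: vec_eq_iff)
qed

lemma unip_nth [simp]:
  "unip x $ Front $ Front = 1 - (norm x)\<^sup>2 / 2"
  "unip x $ Front $ Mid b = x $ b"
  "unip x $ Front $ Back = (norm x)\<^sup>2 / 2"
  "unip x $ Mid a $ Front = - (x $ a)"
  "unip x $ Mid a $ Mid b = (if a = b then 1 else 0)"
  "unip x $ Mid a $ Back = x $ a"
  "unip x $ Back $ Front = - ((norm x)\<^sup>2 / 2)"
  "unip x $ Back $ Mid b = x $ b"
  "unip x $ Back $ Back = 1 + (norm x)\<^sup>2 / 2"
  by (simp_all add: unip_def)

lemma block_diag_nth [simp]:
  "block_diag m $ Front $ Front = 1"
  "block_diag m $ Front $ Mid b = 0"
  "block_diag m $ Front $ Back = 0"
  "block_diag m $ Mid a $ Front = 0"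
  "block_diag m $ Mid a $ Mid b = m $ a $ b"
  "block_diag m $ Mid a $ Back = 0"
  "block_diag m $ Back $ Front = 0"
  "block_diag m $ Back $ Mid b = 0"
  "block_diag m $ Back $ Back = 1"
  by (simp_all add: block_diag_def)

definition mid :: "real ^ 'n \<Rightarrow> ('n::finite) vec2" where
  "mid x = (\<chi> j. case j of Mid a \<Rightarrow> x $ a | _ \<Rightarrow> 0)"

lemma mid_nth [simp]: "mid x $ Front = 0" "mid x $ Mid a = x $ a" "mid x $ Back = 0"
  by (simp_all add: mid_def)

lemma e0_nth [simp]: "e0 $ Front = -1" "e0 $ Mid a = 0" "e0 $ Back = 1"
  by (simp_all add: e0_def)

lemma mid_add: "mid (x + y) = mid x + mid y"
  by (rule vec_idx_eqI) auto

lemma form_e0: "form u e0 = - (u $ Front + u $ Back)"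
  by (simp add: form_split)

lemma form_mid: "form u (mid x) = (\<Sum>a\<in>UNIV. u $ Mid a * x $ a)"
  by (simp add: form_split)

lemma form_mid_mid: "form (mid x) (mid y) = x \<bullet> y"
  by (simp add: form_mid inner_vec_def)

lemma form_e0_e0: "form e0 e0 = 0"
  by (simp add: form_e0)

lemma form_mid_e0: "form (mid x) e0 = 0" "form e0 (mid x) = 0"
  by (simp_all add: form_e0 form_commute[of e0])

text \<open>
In coordinate-free form \<open>unip x\<close> is the Eichler transvection attached to the isotropic vector \<open>e0\<close> and
the vector \<open>mid x\<close> orthogonal to it. This formula can be transported by any isometry, which is how
the integral elements of a conjugate of \<open>U\<close> are recognised later.
\<close>

lemma vector_unip:
  "u v* unip x =
     u - form u e0 *\<^sub>R mid x + (form u (mid x) - form u e0 * (x \<bullet> x) / 2) *\<^sub>R e0"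
  by (rule vec_idx_eqI)
     (simp_all add: vector_matrix_mult_def sum_idx form_e0 form_mid power2_norm_eq_inner
        sum_negf algebra_simps if_distrib add_divide_distrib diff_divide_distrib cong: if_cong)

lemma matrix_eqI_action:
  fixes h k :: "('n::finite) mat2"
  assumes "\<And>u. u v* h = u v* k"
  shows "h = k"
  using assms[of "axis _ 1"] by (simp add: axis_vector_matrix vec_eq_iff)

lemma unip_add: "unip x ** unip y = unip (x + y)"
proof (rule matrix_eqI_action)
  fix u :: "'a vec2"
  show "u v* (unip x ** unip y) = u v* unip (x + y)"
    by (simp add: vector_matrix_mul_assoc[symmetric] vector_unip form_linear form_mid_mid form_mid_e0
        form_e0_e0 mid_add inner_simps inner_commute scaleR_add_left scaleR_diff_left scaleR_add_right
        algebra_simps add_divide_distrib)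
qed

lemma unip_0: "unip 0 = mat 1"
proof (rule matrix_eqI_action)
  fix u :: "'a vec2"
  have "mid (0 :: real ^ 'a) = 0" by (rule vec_idx_eqI) auto
  then show "u v* unip 0 = u v* mat 1" by (simp add: vector_unip form_def)
qed

lemma unip_form_preserving: "form_preserving (unip x)"
  unfolding form_preserving_def
proof (intro allI)
  fix u w :: "'a vec2"
  show "form (u v* unip x) (w v* unip x) = form u w"
    by (simp add: vector_unip form_linear form_mid_mid form_mid_e0 form_e0_e0 
        form_commute[of "mid x" u] form_commute[of "mid x" w] form_commute[of e0 u]  form_commute[of e0 w] 
        algebra_simps)
qed

lemma det_form_preserving: "form_preserving h \<Longrightarrow> det h * det (matrix_inv h) = 1"
  by (metis form_preserving_inv(2) det_I det_mul)

text \<open>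
A \<open>form\<close>-preserving matrix has determinant \<open>1\<close> or \<open>-1\<close>, and \<open>unip x\<close> is the square of \<open>unip (x/2)\<close>.
\<close>

lemma unip_SOQ: "unip x \<in> SOQ"
proof -
  have "form_adjoint h = D ** transpose h ** D" if "D = (\<chi> i j. if i = j then signature i else 0)"
    for h D :: "'a mat2"
    unfolding that by (simp add: form_adjoint_def matrix_matrix_mult_def vec_eq_iff transpose_def
        if_distrib if_distribR cong: if_cong)
  then obtain D where D: "\<And>h :: 'a mat2. form_adjoint h = D ** transpose h ** D" by blast
  have "form_adjoint (mat 1) = (mat 1 :: 'a mat2)"
    by (metis form_adjoint_inverse(1) form_preserving_mat_1 matrix_mul_lid)
  then have "det D * det D = 1"
    by (metis D det_I det_mul matrix_mul_rid transpose_mat)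
  moreover have "det (matrix_inv h) = det D * det D * det h" if "form_preserving h" for h :: "'a mat2"
    by (simp add: form_preserving_inv(1)[OF that] D det_mul det_transpose mult_ac)
  ultimately have "det h * det h = 1" if "form_preserving h" for h :: "'a mat2"
    using det_form_preserving[OF that] that by simp
  moreover have "unip x = unip ((1/2) *\<^sub>R x) ** unip ((1/2) *\<^sub>R x)"
    by (simp add: unip_add flip: scaleR_add_left)
  ultimately show ?thesis
    by (metis SOQ_iff det_mul unip_form_preserving)
qed

lemma vector_block_diag_nth:
  "(u v* block_diag m) $ Front = u $ Front" "(u v* block_diag m) $ Back = u $ Back"
  "(u v* block_diag m) $ Mid b = ((\<chi> a. u $ Mid a) v* m) $ b"
  by (simp_all add: vector_matrix_mult_def sum_idx)

lemma e0_block_diag: "e0 v* block_diag m = e0"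
  by (rule vec_idx_eqI) (simp_all add: vector_matrix_mult_def sum_idx)

lemma mid_block_diag: "mid z v* block_diag m = mid (z v* m)"
  by (rule vec_idx_eqI) (simp_all add: vector_matrix_mult_def sum_idx)

lemma block_diag_mult: "block_diag m ** block_diag k = block_diag (m ** k)"
  by (intro matrix_eqI_action vec_idx_eqI)
     (simp_all add: vector_matrix_mul_assoc[symmetric] vector_block_diag_nth vec_lambda_eta)

lemma block_diag_form_preserving:
  assumes "orthogonal_matrix m"
  shows "form_preserving (block_diag m)"
  unfolding form_preserving_def
proof (intro allI)
  fix u w :: "'a vec2"
  let ?u = "\<chi> a. u $ Mid a" and ?w = "\<chi> a. w $ Mid a"
  have "(?u v* m) \<bullet> (?w v* m) = ?u \<bullet> (m *v (transpose m *v ?w))"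
    by (simp add: dot_lmul_matrix)
  also have "\<dots> = ?u \<bullet> ?w"
    using assms by (simp add: matrix_vector_mul_assoc orthogonal_matrix_def del: transpose_matrix_vector)
  finally show "form (u v* block_diag m) (w v* block_diag m) = form u w"
    by (simp add: form_split vector_block_diag_nth inner_vec_def)
qed

lemma orthogonal_matrix_cancel:
  fixes m :: "real ^ 'n ^ 'n::finite"
  assumes "orthogonal_matrix m"
  shows "(m *v x) v* m = x" "m *v (x v* m) = x" "norm (m *v x) = norm x" "norm (x v* m) = norm x"
proof -
  show *: "(m *v x) v* m = x" for x
    using assms unfolding transpose_matrix_vector[symmetric]
    by (simp add: matrix_vector_mul_assoc orthogonal_matrix_def del: transpose_matrix_vector)
  show "m *v (x v* m) = x" for x
    using assms unfolding transpose_matrix_vector[symmetric]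
    by (simp add: matrix_vector_mul_assoc orthogonal_matrix_def del: transpose_matrix_vector)
  show **: "norm (m *v x) = norm x" for x
    using dot_lmul_matrix[of "m *v x" m x] by (simp add: * norm_eq_sqrt_inner)
  show "norm (x v* m) = norm x"
    using **[of "x v* m"] \<open>m *v (x v* m) = x\<close> by simp
qed

text \<open>
\<open>M\<close> normalises \<open>U\<close>, acting on the parameter by isometries. Together with \<open>unip_add\<close> this is the
multiplication table of \<open>L\<close>, and it is the reason why the measure \<open>dx d\<mu>M\<close> is left invariant.
\<close>

lemma block_diag_unip:
  assumes "orthogonal_matrix m"
  shows "block_diag m ** unip x = unip (m *v x) ** block_diag m"
proof (rule matrix_eqI_action)
  fix u :: "'a vec2"
  have mid: "mid (m *v x) v* block_diag m = mid x"
    by (simp add: mid_block_diag orthogonal_matrix_cancel[OF assms])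
  have 1: "form (u v* block_diag m) (mid x) = form u (mid (m *v x))"
    using form_preservingD[OF block_diag_form_preserving[OF assms], of u "mid (m *v x)"] by (simp add: mid)
  have 2: "form (u v* block_diag m) e0 = form u e0"
    using form_preservingD[OF block_diag_form_preserving[OF assms], of u e0] by (simp add: e0_block_diag)
  have 3: "(m *v x) \<bullet> (m *v x) = x \<bullet> x"
    using orthogonal_matrix_cancel(3)[OF assms, of x] by (simp add: norm_eq)
  show "u v* (block_diag m ** unip x) = u v* (unip (m *v x) ** block_diag m)"
    by (simp add: vector_matrix_mul_assoc[symmetric] vector_unip 1 2 3 mid e0_block_diag
        vector_matrix_left_distrib vector_matrix_mult_diff_distrib
        scaleR_vector_matrix_assoc)
qed

text \<open>
In the Leibniz formula a permutation contributes only if it fixes \<open>Front\<close> and \<open>Back\<close>; such permutations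
are the extensions of the permutations of the middle indices, with the same sign.
\<close>

lemma det_block_diag: "det (block_diag m) = det m"
proof -
  let ?A = "block_diag m"
  let ?term = "\<lambda>q. of_int (sign q) * (\<Prod>i\<in>UNIV. ?A $ i $ q i)"
  let ?ext = "map_permutation UNIV (Mid :: 'a \<Rightarrow> 'a idx)"
  have inj: "inj (Mid :: 'a \<Rightarrow> 'a idx)" by (auto intro: injI)
  have "det ?A = (\<Sum>q | q permutes UNIV. ?term q)"
    by (simp add: det_def)
  also have "\<dots> = (\<Sum>q | q permutes range Mid. ?term q)"
  proof (rule sum.mono_neutral_right)
    show "finite {q. q permutes (UNIV :: 'a idx set)}" by (simp add: finite_permutations)
    show "{q. q permutes range Mid} \<subseteq> {q. q permutes (UNIV :: 'a idx set)}"
      by (auto intro: permutes_subset)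
    show "\<forall>q\<in>{q. q permutes UNIV} - {q. q permutes range Mid}. ?term q = 0"
    proof
      fix q assume "q \<in> {q. q permutes (UNIV :: 'a idx set)} - {q. q permutes range Mid}"
      then obtain i where i: "i \<notin> range Mid" "q i \<noteq> i"
        unfolding permutes_def by blast
      then have "?A $ i $ q i = 0" by (cases i; cases "q i") auto
      then show "?term q = 0" by (metis UNIV_I finite mult_zero_right prod_zero)
    qed
  qed
  also have "\<dots> = (\<Sum>p | p permutes UNIV. ?term (?ext p))"
  proof (rule sum.reindex_bij_betw[symmetric])
    have "bij_betw (Mid :: 'a \<Rightarrow> 'a idx) UNIV (range Mid)" using inj by (simp add: bij_betw_def)
    from bij_betw_permutations[OF this]
    show "bij_betw ?ext {p. p permutes UNIV} {q. q permutes range Mid}"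
      by (simp add: map_permutation_def restrict_id_def fun_eq_iff comp_def cong: bij_betw_cong if_cong)
  qed
  also have "\<dots> = (\<Sum>p | p permutes UNIV. of_int (sign p) * (\<Prod>a\<in>UNIV. m $ a $ p a))"
  proof (rule sum.cong)
    fix p :: "'a \<Rightarrow> 'a" assume "p \<in> {p. p permutes UNIV}"
    then have "p permutes UNIV" by simp
    have mid: "?ext p (Mid a) = Mid (p a)" for a
      by (rule map_permutation_apply) (use inj in auto)
    have "?ext p permutes range Mid"
      by (rule map_permutation_permutes) (use inj \<open>p permutes UNIV\<close> in \<open>auto simp: bij_betw_def\<close>)
    then have "?ext p Front = Front" "?ext p Back = Back"
      by (auto simp: permutes_def)
    moreover have "sign (?ext p) = sign p"
      by (rule sign_map_permutation) (use inj \<open>p permutes UNIV\<close> in auto)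
    ultimately show "?term (?ext p) = of_int (sign p) * (\<Prod>a\<in>UNIV. m $ a $ p a)"
      by (simp add: prod_idx mid)
  qed simp
  also have "\<dots> = det m" by (simp add: det_def)
  finally show ?thesis .
qed

lemma form_preserving_rows:
  assumes "form_preserving h"
  shows "form (h $ i) (h $ j) = (if i = j then signature i else 0)"
  using form_preservingD[OF assms, of "axis i 1" "axis j 1"]
  unfolding axis_vector_matrix form_axis by (simp add: axis_def)

text \<open>
An isometry that preserves the line of \<open>e0\<close> also preserves its orthogonal complement, which is spanned
by \<open>e0\<close> and the middle coordinates. On the quotient of the complement by the line, \<open>form\<close> is the
Euclidean inner product, so the middle block of the isometry is orthogonal.
\<close>

lemma scaling_e0_mid_block:
  assumes pres: "form_preserving h" and e0: "e0 v* h = c *\<^sub>R e0" "c \<noteq> 0"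
  shows "h $ Mid a $ Front = - h $ Mid a $ Back"
    and "orthogonal_matrix (\<chi> a b. h $ Mid a $ Mid b)"
proof -
  show *: "h $ Mid a $ Front = - h $ Mid a $ Back" for a
  proof -
    have "form (h $ Mid a) (c *\<^sub>R e0) = form (axis (Mid a) 1) e0"
      using form_preservingD[OF pres, of "axis (Mid a) 1" e0] by (simp add: axis_vector_matrix e0(1))
    then show ?thesis using e0(2) by (simp add: form_linear form_e0 axis_def)
  qed
  let ?m = "\<chi> a b. h $ Mid a $ Mid b"
  have "(?m ** transpose ?m) $ a $ b = mat 1 $ a $ b" for a b
    using form_preserving_rows[OF pres, of "Mid a" "Mid b"] *[of a] *[of b]
    by (simp add: form_split matrix_matrix_mult_def transpose_def mat_def axis_def)
  then have "?m ** transpose ?m = mat 1" by (simp add: vec_eq_iff)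
  then show "orthogonal_matrix ?m"
    by (simp add: orthogonal_matrix matrix_left_right_inverse)
qed

text \<open>
Both factors of \<open>h = unip x ** block_diag m\<close> can be read off from the middle rows of \<open>h\<close>: \<open>m\<close> is the
middle block, orthogonal by \<open>scaling_e0_mid_block\<close>, and \<open>x\<close> is the last column. The row of \<open>Front\<close>
is then forced by its products with the other rows, and the row of \<open>Back\<close> differs from it by \<open>e0\<close>.
\<close>

lemma stabilizer_e0_subset_grpL:
  assumes h: "h \<in> SOQ" and e0: "e0 v* h = e0"
  shows "h \<in> grpL"
proof -
  define m where "m = (\<chi> a b. h $ Mid a $ Mid b)"
  define x where "x = (\<chi> a. h $ Mid a $ Back)"
  define y where "y = (\<chi> b. h $ Front $ Mid b)"
  have pres: "form_preserving h" using h by (simp add: SOQ_iff)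
  note rows = form_preserving_rows[OF pres]
  have row_e0: "form (h $ i) e0 = form (axis i 1) e0" for i
    using form_preservingD[OF pres, of "axis i 1" e0] by (simp add: axis_vector_matrix e0)
  have back_row: "h $ Back $ j = h $ Front $ j + e0 $ j" for j
    using e0[unfolded vec_eq_iff, rule_format, of j]
    by (simp add: vector_matrix_mult_def sum_idx)
  have mid_front: "h $ Mid a $ Front = - x $ a" for a
    using scaling_e0_mid_block(1)[OF pres, of 1] e0 by (simp add: x_def)
  have orth: "orthogonal_matrix m"
    unfolding m_def using scaling_e0_mid_block(2)[OF pres, of 1] e0 by simp
  have sum_front: "h $ Front $ Front + h $ Front $ Back = 1"
    using row_e0[of Front] by (simp add: form_e0 axis_def)
  have "(m *v y) $ a = x $ a" for a
  proof -
    have "(m *v y) $ a = x $ a * (h $ Front $ Front + h $ Front $ Back)"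
      using rows[of "Mid a" Front] mid_front[of a]
      by (simp add: form_split matrix_vector_mult_def m_def x_def y_def axis_def algebra_simps)
    then show ?thesis by (simp add: sum_front)
  qed
  then have "m *v y = x" by (simp add: vec_eq_iff)
  then have y: "y = x v* m" and "norm y = norm x"
    using orthogonal_matrix_cancel[OF orth] by auto
  have "h $ Front $ Front * h $ Front $ Front + (norm x)\<^sup>2 - h $ Front $ Back * h $ Front $ Back = 1"
    using rows[of Front Front] 
    by (simp add: \<open>norm y = norm x\<close>[symmetric] form_split power2_norm_eq_inner inner_vec_def y_def axis_def)
  moreover have "h $ Front $ Back = 1 - h $ Front $ Front" using sum_front by simp
  ultimately have front: "h $ Front $ Front = 1 - (norm x)\<^sup>2 / 2" "h $ Front $ Back = (norm x)\<^sup>2 / 2"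
    by (simp_all add: algebra_simps)
  have y_nth: "h $ Front $ Mid b = (\<Sum>a\<in>UNIV. x $ a * m $ a $ b)" for b
    using arg_cong[OF y, of "\<lambda>y. y $ b"] by (simp add: y_def vector_matrix_mult_def)
  have "h = unip x ** block_diag m"
    by (intro vec_idx_eqI)
       (simp_all add: matrix_matrix_mult_def sum_idx front back_row mid_front y_nth m_def x_def
          if_distrib if_distribR cong: if_cong)
  moreover have "det m = 1"
    using h \<open>h = _\<close> unip_SOQ[of x] by (simp add: SOQ_iff det_mul det_block_diag)
  ultimately show ?thesis
    using orth by (auto simp: grpL_def grpM_def rotation_matrix_def)
qed

lemma grpM_iff: "k \<in> grpM \<longleftrightarrow> (\<exists>m. k = block_diag m \<and> rotation_matrix m)"
  by (auto simp: grpM_def)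

lemma grpL_iff: "l \<in> grpL \<longleftrightarrow> (\<exists>x m. l = unip x ** block_diag m \<and> rotation_matrix m)"
  by (auto simp: grpL_def grpM_def)

lemma grpL_form_preserving: "l \<in> grpL \<Longrightarrow> form_preserving l"
  unfolding grpL_iff rotation_matrix_def
  using form_preserving_mult unip_form_preserving block_diag_form_preserving by blast

lemma grpM_mult: "k \<in> grpM \<Longrightarrow> k' \<in> grpM \<Longrightarrow> k ** k' \<in> grpM"
  unfolding grpM_iff rotation_matrix_def
  by (metis block_diag_mult det_mul mult_1 orthogonal_matrix_mul)

lemma unip_block_mult:
  assumes "orthogonal_matrix m"
  shows "(unip y ** block_diag m) ** (unip x ** k) = unip (y + m *v x) ** (block_diag m ** k)"
proof -
  have "(unip y ** block_diag m) ** (unip x ** k) = unip y ** (block_diag m ** unip x) ** k"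
    by (simp add: matrix_mul_assoc)
  then show ?thesis
    by (simp add: block_diag_unip[OF assms] unip_add matrix_mul_assoc)
qed

lemma grpL_mult: "l \<in> grpL \<Longrightarrow> l' \<in> grpL \<Longrightarrow> l ** l' \<in> grpL"
proof -
  assume "l \<in> grpL" "l' \<in> grpL"
  then obtain y m x k where "l = unip y ** block_diag m" "rotation_matrix m" "l' = unip x ** k" "k \<in> grpM"
    unfolding grpL_iff[of l] grpL_def[THEN eqset_imp_iff, of l'] by blast
  then show ?thesis
    using grpM_mult[of "block_diag m" k] 
    by (auto simp: unip_block_mult rotation_matrix_def grpL_def grpM_iff)
qed

section \<open>Fundamental domains and covolumes\<close>

text \<open>
The setting in which covolumes can be compared. Countability allows measures of pieces to be summed over
the group, and freeness makes the group element that carries one point of an orbit to another unique.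
\<close>

locale matrix_action =
  fixes \<mu> :: "('n::finite) mat2 measure" and H :: "'n mat2 set"
  assumes countable: "countable H"
    and one: "mat 1 \<in> H"
    and mult: "\<And>h k. h \<in> H \<Longrightarrow> k \<in> H \<Longrightarrow> h ** k \<in> H"
    and inverse: "\<And>h. h \<in> H \<Longrightarrow> matrix_inv h \<in> H"
    and left_inverse: "\<And>h. h \<in> H \<Longrightarrow> matrix_inv h ** h = mat 1"
    and measurable_action: "\<And>h. h \<in> H \<Longrightarrow> (\<lambda>l. h ** l) \<in> measurable \<mu> \<mu>"
    and invariant: "\<And>h. h \<in> H \<Longrightarrow> distr \<mu> \<mu> (\<lambda>l. h ** l) = \<mu>"
    and free: "\<And>h l. h \<in> H \<Longrightarrow> l \<in> space \<mu> \<Longrightarrow> h ** l = l \<Longrightarrow> h = mat 1"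
begin

lemma right_inverse: "h \<in> H \<Longrightarrow> h ** matrix_inv h = mat 1"
  using left_inverse by (simp add: matrix_left_right_inverse)

lemma action_closed: "h \<in> H \<Longrightarrow> l \<in> space \<mu> \<Longrightarrow> h ** l \<in> space \<mu>"
  by (rule measurable_space[OF measurable_action])

lemma cancel_inverse [simp]:
  "h \<in> H \<Longrightarrow> matrix_inv h ** (h ** l) = l" "h \<in> H \<Longrightarrow> h ** (matrix_inv h ** l) = l"
  by (simp_all add: matrix_mul_assoc left_inverse right_inverse)

lemma free_cancel:
  assumes "h \<in> H" "k \<in> H" "l \<in> space \<mu>" "h ** l = k ** l"
  shows "h = k"
proof -
  have "(matrix_inv k ** h) ** l = l"
    using assms by (simp add: matrix_mul_assoc[symmetric])
  then have "matrix_inv k ** h = mat 1"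
    using assms by (intro free[of _ l] mult inverse) auto
  then show ?thesis
    using cancel_inverse(2)[OF assms(2), of h] by simp
qed

lemma preimage_sets:
  assumes "h \<in> H" "A \<in> sets \<mu>"
  shows "{l \<in> space \<mu>. h ** l \<in> A} \<in> sets \<mu>"
  using measurable_sets[OF measurable_action[OF assms(1)] assms(2)]
  by (simp add: vimage_def Int_def conj_commute)

lemma emeasure_preimage:
  assumes "h \<in> H" "A \<in> sets \<mu>"
  shows "emeasure \<mu> {l \<in> space \<mu>. h ** l \<in> A} = emeasure \<mu> A"
proof -
  have "emeasure \<mu> A = emeasure (distr \<mu> \<mu> (\<lambda>l. h ** l)) A" by (simp add: invariant assms)
  also have "\<dots> = emeasure \<mu> ((\<lambda>l. h ** l) -` A \<inter> space \<mu>)"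
    by (rule emeasure_distr[OF measurable_action]) (use assms in auto)
  finally show ?thesis by (simp add: vimage_def Int_def conj_commute)
qed

lemma fundamental_domainD:
  assumes "fundamental_domain \<mu> H D"
  shows "D \<in> sets \<mu>" "D \<subseteq> space \<mu>"
    "\<And>l. l \<in> space \<mu> \<Longrightarrow> \<exists>h\<in>H. h ** l \<in> D"
    "\<And>l h k. l \<in> space \<mu> \<Longrightarrow> h \<in> H \<Longrightarrow> k \<in> H \<Longrightarrow> h ** l \<in> D \<Longrightarrow> k ** l \<in> D \<Longrightarrow> h = k"
proof -
  show "D \<in> sets \<mu>" using assms by (simp add: fundamental_domain_def)
  then show "D \<subseteq> space \<mu>" by (rule sets.sets_into_space)
  show "\<exists>h\<in>H. h ** l \<in> D" if "l \<in> space \<mu>" for l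
    using assms that unfolding fundamental_domain_def by blast
  show "h = k" if "l \<in> space \<mu>" "h \<in> H" "k \<in> H" "h ** l \<in> D" "k ** l \<in> D" for l h k
  proof -
    have "h ** l = k ** l" using assms that unfolding fundamental_domain_def by blast
    with that show ?thesis using free_cancel by blast
  qed
qed

lemma fundamental_domainI:
  assumes "D \<in> sets \<mu>" "\<And>l. l \<in> space \<mu> \<Longrightarrow> \<exists>h\<in>H. h ** l \<in> D"
    "\<And>l h. l \<in> D \<Longrightarrow> h \<in> H \<Longrightarrow> h ** l \<in> D \<Longrightarrow> h ** l = l"
  shows "fundamental_domain \<mu> H D"
  unfolding fundamental_domain_def
proof (intro conjI ballI)
  fix l assume l: "l \<in> space \<mu>"
  then obtain h where h: "h \<in> H" "h ** l \<in> D" using assms(2) by blast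
  show "\<exists>!d. d \<in> D \<and> (\<exists>h\<in>H. d = h ** l)"
  proof (rule ex1I[of _ "h ** l"])
    show "h ** l \<in> D \<and> (\<exists>k\<in>H. h ** l = k ** l)" using h by blast
    fix d assume "d \<in> D \<and> (\<exists>k\<in>H. d = k ** l)"
    then obtain k where k: "k \<in> H" "d = k ** l" "d \<in> D" by blast
    have "(k ** matrix_inv h) ** (h ** l) = d"
      using h k by (simp add: matrix_mul_assoc[symmetric])
    moreover have "k ** matrix_inv h \<in> H" using h k by (intro mult inverse)
    ultimately show "d = h ** l" using assms(3)[OF h(2), of "k ** matrix_inv h"] k by simp
  qed
qed (use assms in auto)

text \<open>
Cut \<open>D\<close> into the pieces \<open>X h\<close> that the group element \<open>h\<close> carries into \<open>D'\<close>. The translates \<open>Y h\<close> of these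
pieces by \<open>h\<close> form a partition of \<open>D'\<close>, and translation preserves the measure.
\<close>

lemma emeasure_fundamental_domain_unique:
  assumes D: "fundamental_domain \<mu> H D" and D': "fundamental_domain \<mu> H D'"
  shows "emeasure \<mu> D = emeasure \<mu> D'"
proof -
  note fD = fundamental_domainD[OF D] and fD' = fundamental_domainD[OF D']
  define X where "X h = {l \<in> D. h ** l \<in> D'}" for h
  define Y where "Y h = {l \<in> D'. matrix_inv h ** l \<in> D}" for h
  have X_alt: "X h = D \<inter> {l \<in> space \<mu>. h ** l \<in> D'}" for h using fD(2) by (auto simp: X_def)
  have Y_alt: "Y h = D' \<inter> {l \<in> space \<mu>. matrix_inv h ** l \<in> D}" for h using fD'(2) by (auto simp: Y_def)
  have X_sets: "X h \<in> sets \<mu>" and Y_sets: "Y h \<in> sets \<mu>" if "h \<in> H" for h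
    unfolding X_alt Y_alt using that fD(1) fD'(1) by (auto intro!: sets.Int preimage_sets inverse)
  have XY: "emeasure \<mu> (X h) = emeasure \<mu> (Y h)" if "h \<in> H" for h
  proof -
    have "Y h = {l \<in> space \<mu>. matrix_inv h ** l \<in> X h}"
      using that fD'(2) by (auto simp: X_def Y_def)
    then show ?thesis using emeasure_preimage[OF inverse[OF that] X_sets[OF that]] by simp
  qed
  have "emeasure \<mu> D = emeasure \<mu> (\<Union>h\<in>H. X h)"
  proof -
    have "D = (\<Union>h\<in>H. X h)" using fD(2) fD'(3) by (force simp: X_def)
    then show ?thesis by simp
  qed
  also have "\<dots> = (\<integral>\<^sup>+h. emeasure \<mu> (X h) \<partial>count_space H)"
  proof (rule emeasure_UN_countable[OF X_sets countable])
    show "disjoint_family_on X H"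
      unfolding disjoint_family_on_def X_def using fD(2) fD'(4) by blast
  qed
  also have "\<dots> = (\<integral>\<^sup>+h. emeasure \<mu> (Y h) \<partial>count_space H)"
    by (intro nn_integral_cong) (simp add: XY)
  also have "\<dots> = emeasure \<mu> (\<Union>h\<in>H. Y h)"
  proof (rule emeasure_UN_countable[OF Y_sets countable, symmetric])
    show "disjoint_family_on Y H"
      unfolding disjoint_family_on_def
    proof (intro ballI impI)
      fix h k assume hk: "h \<in> H" "k \<in> H" "h \<noteq> k"
      have "matrix_inv h \<noteq> matrix_inv k"
        using hk by (metis left_inverse cancel_inverse(2) matrix_mul_rid)
      then show "Y h \<inter> Y k = {}"
        unfolding Y_def using hk fD'(2) fD(4) inverse by blast
    qed
  qed
  also have "(\<Union>h\<in>H. Y h) = D'"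
  proof -
    have "\<exists>h\<in>H. matrix_inv h ** l \<in> D" if l: "l \<in> D'" for l
    proof -
      obtain h where h: "h \<in> H" "h ** l \<in> D" using l fD'(2) fD(3) by blast
      have "matrix_inv (matrix_inv h) = h"
        by (rule matrix_inv_eqI) (use h left_inverse in auto)
      with h inverse show ?thesis by force
    qed
    then show ?thesis by (auto simp: Y_def)
  qed
  finally show ?thesis .
qed

lemma covolume_eq:
  assumes "fundamental_domain \<mu> H D"
  shows "covolume \<mu> H = emeasure \<mu> D"
  unfolding covolume_def
proof (rule the_equality)
  show "\<exists>D'. fundamental_domain \<mu> H D' \<and> emeasure \<mu> D = emeasure \<mu> D'"
    using assms by (intro exI[of _ D] conjI) simp_all
  fix c assume "\<exists>D'. fundamental_domain \<mu> H D' \<and> c = emeasure \<mu> D'"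
  then obtain D' where "fundamental_domain \<mu> H D'" "c = emeasure \<mu> D'" by auto
  then show "c = emeasure \<mu> D"
    using emeasure_fundamental_domain_unique[OF assms] by simp
qed

text \<open>
If \<open>R\<close> represents the right cosets of the subgroup \<open>K\<close> in \<open>H\<close>, then the disjoint union of the translates
\<open>r D\<close> with \<open>r\<close> in \<open>R\<close> is a fundamental domain for \<open>K\<close>. So the covolume of \<open>K\<close> is the index times the
covolume of \<open>H\<close>, where the index may be infinite.
\<close>

lemma covolume_subgroup:
  assumes K: "matrix_action \<mu> K" "K \<subseteq> H" and D: "fundamental_domain \<mu> H D"
  shows "\<exists>R :: 'n mat2 set. R \<noteq> {} \<and> covolume \<mu> K = emeasure (count_space UNIV) R * covolume \<mu> H"
proof -
  interpret K: matrix_action \<mu> K by fact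
  note fD = fundamental_domainD[OF D]
  define coset where "coset h = {k ** h | k. k \<in> K}" for h :: "'n mat2"
  define rep where "rep h = (SOME r. r \<in> coset h)" for h
  define R where "R = rep ` H"
  have rep: "\<exists>k\<in>K. rep h = k ** h" if "h \<in> H" for h
  proof -
    have "h \<in> coset h" using K.one by (force simp: coset_def)
    then have "rep h \<in> coset h" unfolding rep_def by (rule someI)
    then show ?thesis by (auto simp: coset_def)
  qed
  have RH: "R \<subseteq> H" using rep mult K(2) by (fastforce simp: R_def)
  have R_ex: "\<exists>r\<in>R. \<exists>k\<in>K. h = k ** r" if h: "h \<in> H" for h
  proof -
    obtain k where "k \<in> K" "rep h = k ** h" using rep[OF h] by blast
    then have "h = matrix_inv k ** rep h" by simp
    then show ?thesis using h \<open>k \<in> K\<close> K.inverse by (auto simp: R_def)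
  qed
  have R_unique: "r = r'" if r: "r \<in> R" "r' \<in> R" "r = k ** r'" "k \<in> K" for r r' k
  proof -
    obtain h h' where h: "h \<in> H" "h' \<in> H" "r = rep h" "r' = rep h'" using r by (auto simp: R_def)
    obtain a a' where a: "a \<in> K" "a' \<in> K" "r = a ** h" "r' = a' ** h'"
      using rep[OF h(1)] rep[OF h(2)] h(3,4) by auto
    have "h = matrix_inv a ** (k ** (a' ** h'))" using r a K.cancel_inverse(1)[OF a(1), of h] by simp
    then have hh': "h = (matrix_inv a ** k ** a') ** h'" by (simp add: matrix_mul_assoc)
    define c where "c = matrix_inv a ** k ** a'"
    have c: "c \<in> K" unfolding c_def using r a K.mult K.inverse by blast
    have "h = c ** h'" using hh' by (simp add: c_def)
    have "coset h = coset h'"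
    proof
      show "coset h \<subseteq> coset h'"
        unfolding coset_def \<open>h = c ** h'\<close> using c by (auto simp: matrix_mul_assoc intro: K.mult)
      show "coset h' \<subseteq> coset h"
      proof
        fix x assume "x \<in> coset h'"
        then obtain b where b: "b \<in> K" "x = b ** h'" by (auto simp: coset_def)
        then have "x = (b ** matrix_inv c) ** h"
          unfolding \<open>h = c ** h'\<close> using c by (simp add: matrix_mul_assoc[symmetric])
        then show "x \<in> coset h" using b c K.mult K.inverse by (auto simp: coset_def)
      qed
    qed
    then show ?thesis by (simp add: h rep_def)
  qed
  define X where "X r = {l \<in> space \<mu>. matrix_inv r ** l \<in> D}" for r
  have X_sets: "X r \<in> sets \<mu>" if "r \<in> R" for r
    unfolding X_def using RH that fD(1) by (auto intro!: preimage_sets inverse)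
  have "countable R" using RH countable by (rule countable_subset)
  have "fundamental_domain \<mu> K (\<Union>r\<in>R. X r)"
  proof (rule K.fundamental_domainI)
    show "(\<Union>r\<in>R. X r) \<in> sets \<mu>" using X_sets \<open>countable R\<close> by blast
    show "\<exists>k\<in>K. k ** l \<in> (\<Union>r\<in>R. X r)" if l: "l \<in> space \<mu>" for l
    proof -
      obtain h where h: "h \<in> H" "h ** l \<in> D" using fD(3) l by blast
      obtain r k where rk: "r \<in> R" "k \<in> K" "matrix_inv h = k ** r" using R_ex inverse h(1) by blast
      have "l = (k ** r) ** (h ** l)" using h by (simp add: rk(3)[symmetric])
      then have "matrix_inv k ** l = r ** (h ** l)"
        using K.cancel_inverse(1)[OF rk(2), of "r ** (h ** l)"] by (simp add: matrix_mul_assoc)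
      then have "matrix_inv r ** (matrix_inv k ** l) = h ** l" using rk RH by auto
      then have "matrix_inv k ** l \<in> X r" 
        using h l rk by (simp add: X_def K.action_closed K.inverse)
      then show ?thesis using rk K.inverse by blast
    qed
    fix l k assume l: "l \<in> (\<Union>r\<in>R. X r)" and k: "k \<in> K" and kl: "k ** l \<in> (\<Union>r\<in>R. X r)"
    obtain r r' where r: "r \<in> R" "r' \<in> R" "l \<in> space \<mu>" "matrix_inv r ** l \<in> D" "matrix_inv r' ** (k ** l) \<in> D"
      using l kl by (auto simp: X_def)
    have eq: "matrix_inv r = matrix_inv r' ** k"
      by (rule fD(4)[OF r(3)]) (use r RH k K(2) in \<open>auto intro!: mult inverse simp: matrix_mul_assoc\<close>)
    have "r' ** matrix_inv r = k" using r RH by (subst eq) auto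
    moreover have "r' = r' ** matrix_inv r ** r"
      using r RH by (auto simp: matrix_mul_assoc[symmetric] left_inverse)
    ultimately have "r' = k ** r" by simp
    then have "r' = r" using R_unique r k by blast
    then have "k = mat 1" using \<open>r' ** matrix_inv r = k\<close> r RH right_inverse by auto
    then show "k ** l = l" by simp
  qed
  then have "covolume \<mu> K = emeasure \<mu> (\<Union>r\<in>R. X r)" by (rule K.covolume_eq)
  also have "\<dots> = (\<integral>\<^sup>+r. emeasure \<mu> (X r) \<partial>count_space R)"
  proof (rule emeasure_UN_countable[OF X_sets \<open>countable R\<close>])
    have "r = r'" if "r \<in> R" "r' \<in> R" "l \<in> X r" "l \<in> X r'" for r r' l
    proof -
      have "matrix_inv r = matrix_inv r'"
        by (rule fD(4)[of l]) (use that RH in \<open>auto simp: X_def intro!: inverse\<close>)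
      then show ?thesis
        using that RH by (metis left_inverse cancel_inverse(2) matrix_mul_rid subsetD)
    qed
    then show "disjoint_family_on X R" by (auto simp: disjoint_family_on_def)
  qed
  also have "\<dots> = (\<integral>\<^sup>+r. emeasure \<mu> D \<partial>count_space R)"
    using RH fD(1) by (intro nn_integral_cong) (auto simp: X_def emeasure_preimage inverse)
  also have "\<dots> = emeasure (count_space UNIV) R * covolume \<mu> H"
    by (simp add: covolume_eq[OF D] mult.commute emeasure_count_space)
  finally have "covolume \<mu> K = emeasure (count_space UNIV) R * covolume \<mu> H" .
  moreover have "R \<noteq> {}" using one by (auto simp: R_def)
  ultimately show ?thesis by (intro exI[of _ R] conjI)
qed

text \<open>
If the index of \<open>K\<close> in \<open>H\<close> is finite, the covolume of \<open>H\<close> is \<open>q\<close> divided by the index. If it is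
infinite, the finiteness of \<open>q\<close> forces the covolume of \<open>H\<close> to be \<open>0\<close>, which is rational as well.
\<close>

lemma covolume_rational:
  assumes K: "matrix_action \<mu> K" "K \<subseteq> H" and D: "fundamental_domain \<mu> H D"
    and q: "covolume \<mu> K = ennreal q" "q \<in> \<rat>" "0 \<le> q"
  shows "\<exists>q\<in>\<rat>. 0 \<le> q \<and> covolume \<mu> H = ennreal q"
proof -
  obtain R :: "'n mat2 set" where R: "R \<noteq> {}" "ennreal q = emeasure (count_space UNIV) R * covolume \<mu> H"
    using covolume_subgroup[OF K D] unfolding q(1) by (elim exE conjE) (rule that)
  show ?thesis
  proof (cases "finite R")
    case False
    have "covolume \<mu> H = 0"
    proof (rule ccontr)
      assume "covolume \<mu> H \<noteq> 0"
      then have "ennreal q = \<infinity>" using R(2) False by (simp add: emeasure_count_space ennreal_top_mult)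
      then show False by simp
    qed
    then show ?thesis by (intro bexI[of _ 0]) auto
  next
    case True
    define c where "c = real (card R)"
    have c: "c > 0" using True R(1) by (simp add: c_def card_gt_0_iff)
    have "ennreal q = ennreal c * covolume \<mu> H"
      using R(2) True by (simp add: c_def emeasure_count_space ennreal_of_nat_eq_real_of_nat)
    moreover have "ennreal q = ennreal c * ennreal (q / c)"
      using c q(3) by (simp flip: ennreal_mult')
    ultimately have "covolume \<mu> H = ennreal (q / c)"
      using c by (simp add: ennreal_mult_cancel_left)
    moreover have "q / c \<in> \<rat>" using q(2) by (simp add: c_def)
    ultimately show ?thesis using q(3) c by (intro bexI[of _ "q / c"]) auto
  qed
qed

text \<open>
Every point has a neighbourhood that is disjoint from its translates by nontrivial elements. By
Lindelof's theorem countably many such sets \<open>B j\<close> cover the space. From each orbit, select its point in the first \<open>B j\<close> that the orbit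
meets; there is exactly one, and the selected points form a Borel set.
\<close>

lemma fundamental_domain_exists:
  assumes sets_\<mu>: "sets \<mu> = sets (restrict_space borel L)"
    and wandering: "\<And>l. l \<in> L \<Longrightarrow>
      \<exists>B. open B \<and> l \<in> B \<and> (\<forall>h\<in>H. \<forall>a\<in>B \<inter> L. h ** a \<in> B \<longrightarrow> h = mat 1)"
  shows "\<exists>D. fundamental_domain \<mu> H D"
proof -
  have L: "space \<mu> = L" using sets_eq_imp_space_eq[OF sets_\<mu>] by (simp add: space_restrict_space)
  have open_sets: "B \<inter> L \<in> sets \<mu>" if "open B" for B
    unfolding sets_\<mu> sets_restrict_space using that by (intro image_eqI[of _ _ B]) auto
  define \<F> where "\<F> = {B. open B \<and> (\<forall>h\<in>H. \<forall>a\<in>B \<inter> L. h ** a \<in> B \<longrightarrow> h = mat 1)}"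
  obtain \<F>' where \<F>': "\<F>' \<subseteq> \<F>" "countable \<F>'" "\<Union>\<F>' = \<Union>\<F>"
    by (rule Lindelof[of \<F>]) (simp_all add: \<F>_def)
  have cover: "L \<subseteq> \<Union>\<F>'"
  proof
    fix l assume "l \<in> L"
    from wandering[OF this] obtain B where "B \<in> \<F>" "l \<in> B" unfolding \<F>_def by auto
    then show "l \<in> \<Union>\<F>'" unfolding \<F>'(3) by auto
  qed
  have "{} \<in> \<F>" by (simp add: \<F>_def)
  \<comment> \<open>The empty set is added so that the enumeration is of a nonempty family.\<close>
  define B where "B = from_nat_into (insert {} \<F>')"
  have range_B: "range B = insert {} \<F>'"
    unfolding B_def using \<F>' by (intro range_from_nat_into) auto
  have B_mem: "B j \<in> \<F>" for j
  proof -
    have "B j \<in> insert {} \<F>'" unfolding range_B[symmetric] by simp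
    then show ?thesis using \<F>'(1) \<open>{} \<in> \<F>\<close> by auto
  qed
  then have B_open: "open (B j)" for j by (simp add: \<F>_def)
  have B_wandering: "h = mat 1" if "h \<in> H" "a \<in> B j" "a \<in> L" "h ** a \<in> B j" for h a j
    using B_mem[of j] that unfolding \<F>_def by auto
  define orbit where "orbit i = (\<Union>h\<in>H. {l \<in> space \<mu>. h ** l \<in> B i \<inter> L})" for i
  define D where "D = (\<Union>j. (B j \<inter> L) - (\<Union>i<j. orbit i))"
  have orbit_sets: "orbit i \<in> sets \<mu>" for i
    unfolding orbit_def using countable open_sets[OF B_open] preimage_sets by blast
  have orbit_iff: "l \<in> orbit i \<longleftrightarrow> l \<in> L \<and> (\<exists>h\<in>H. h ** l \<in> B i)" for l i
    using action_closed by (auto simp: orbit_def L)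
  have orbit_self: "l \<in> orbit i" if "l \<in> B i" "l \<in> L" for l i
    unfolding orbit_iff using that one by (intro conjI bexI[of _ "mat 1"]) simp_all
  have orbit_inv: "h ** l \<in> orbit i \<longleftrightarrow> l \<in> orbit i" if "h \<in> H" "l \<in> L" for h l i
  proof
    assume "h ** l \<in> orbit i"
    then obtain k where "k \<in> H" "k ** (h ** l) \<in> B i" by (auto simp: orbit_iff)
    then show "l \<in> orbit i" using that mult[of k h] by (auto simp: orbit_iff matrix_mul_assoc)
  next
    assume "l \<in> orbit i"
    then obtain k where k: "k \<in> H" "k ** l \<in> B i" by (auto simp: orbit_iff)
    have "(k ** matrix_inv h) ** (h ** l) = k ** l" using that by (simp add: matrix_mul_assoc[symmetric])
    then have "(k ** matrix_inv h) ** (h ** l) \<in> B i" using k by simp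
    moreover have "k ** matrix_inv h \<in> H" using k that by (intro mult inverse)
    moreover have "h ** l \<in> L" using that action_closed by (simp add: L)
    ultimately show "h ** l \<in> orbit i" unfolding orbit_iff by blast
  qed
  have "fundamental_domain \<mu> H D"
  proof (rule fundamental_domainI)
    show "D \<in> sets \<mu>"
      unfolding D_def
      by (intro sets.countable_UN image_subsetI sets.Diff sets.finite_UN open_sets B_open orbit_sets) simp
    show "\<exists>h\<in>H. h ** l \<in> D" if "l \<in> space \<mu>" for l
    proof -
      have l: "l \<in> L" using that L by simp
      have "\<exists>j. l \<in> orbit j"
      proof -
        have "l \<in> \<Union>(range B)" using l cover unfolding range_B by auto
        then obtain j where "l \<in> B j" by auto
        then show ?thesis using l orbit_self by blast
      qed
      define j where "j = (LEAST j. l \<in> orbit j)"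
      have j: "l \<in> orbit j" "\<And>i. i < j \<Longrightarrow> l \<notin> orbit i"
        unfolding j_def by (rule LeastI_ex[OF \<open>\<exists>j. l \<in> orbit j\<close>], rule not_less_Least)
      then obtain h where h: "h \<in> H" "h ** l \<in> B j" by (auto simp: orbit_iff)
      have "h ** l \<in> D" unfolding D_def using h l j orbit_inv action_closed L by auto
      with h show ?thesis by blast
    qed
    fix l h assume l: "l \<in> D" and h: "h \<in> H" and hl: "h ** l \<in> D"
    obtain j where j: "l \<in> B j" "l \<in> L" "\<And>i. i < j \<Longrightarrow> l \<notin> orbit i" using l by (auto simp: D_def)
    obtain k where k: "h ** l \<in> B k" "\<And>i. i < k \<Longrightarrow> h ** l \<notin> orbit i" using hl by (auto simp: D_def)
    have "l \<in> orbit j" "l \<in> orbit k"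
      using orbit_self[OF j(1,2)] orbit_self[OF k(1)] orbit_inv[OF h j(2)] action_closed[OF h] j(2)
      by (simp_all add: L)
    then have "\<not> j < k" "\<not> k < j" using j k orbit_inv[OF h j(2)] by auto
    then have "h = mat 1" using B_wandering[OF h j(1,2)] k(1) by simp
    then show "h ** l = l" by simp
  qed
  then show ?thesis by (rule exI)
qed

end

section \<open>Invariance of the measure on L\<close>

lemma continuous_on_unip [continuous_intros]:
  assumes "continuous_on S f"
  shows "continuous_on S (\<lambda>x. unip (f x))"
  unfolding unip_def
proof (intro continuous_on_vec_lambda)
  fix i j
  show "continuous_on S (\<lambda>x. case i of
       Front \<Rightarrow> (case j of Front \<Rightarrow> 1 - (norm (f x))\<^sup>2 / 2 | Mid b \<Rightarrow> f x $ b | Back \<Rightarrow> (norm (f x))\<^sup>2 / 2)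
     | Mid a \<Rightarrow> (case j of Front \<Rightarrow> - (f x $ a) | Mid b \<Rightarrow> (if a = b then 1 else 0) | Back \<Rightarrow> f x $ a)
     | Back \<Rightarrow> (case j of Front \<Rightarrow> - ((norm (f x))\<^sup>2 / 2) | Mid b \<Rightarrow> f x $ b | Back \<Rightarrow> 1 + (norm (f x))\<^sup>2 / 2))"
    by (cases i; cases j) (auto intro!: continuous_intros assms)
qed

text \<open>
The component \<open>x\<close> of \<open>unip x ** k\<close>, read off from the matrix entries, so that it is visibly continuous.
\<close>

definition shift_coordinate :: "('n::finite) mat2 \<Rightarrow> real ^ 'n" where
  "shift_coordinate l = (\<chi> a. l $ Mid a $ Back)"

lemma shift_coordinate_unip: 
  assumes "k \<in> grpM" shows "shift_coordinate (unip x ** k) = x"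
  using assms by (auto simp: shift_coordinate_def grpM_iff matrix_matrix_mult_def sum_idx vec_eq_iff)

lemma continuous_on_shift_coordinate: "continuous_on S shift_coordinate"
  unfolding shift_coordinate_def by (intro continuous_intros)

text \<open>
Let \<open>N\<close> be the image of Lebesgue measure \<open>\<lambda>\<close> under the orthogonal map; it is again translation invariant.
For the unit ball \<open>B\<close>, evaluating the double integral of \<open>1\<^sub>A(x) 1\<^sub>B(y)\<close> over \<open>N\<close> and \<open>\<lambda>\<close> after the shear
\<open>x \<mapsto> x + y\<close> gives \<open>N(A) \<lambda>(B) = \<lambda>(A) N(B)\<close>. An orthogonal map takes balls to balls of the same radius,
so \<open>N(B) = \<lambda>(B)\<close>, and therefore \<open>N = \<lambda>\<close>.
\<close>

lemma lborel_distr_orthogonal: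
  fixes f :: "'a::euclidean_space \<Rightarrow> 'a"
  assumes f: "orthogonal_transformation f"
  shows "distr lborel borel f = lborel"
proof -
  define N where "N = distr lborel borel f"
  let ?g = "inv_into UNIV f"
  have bij: "bij f" using f by (rule orthogonal_transformation_bij)
  have gf: "?g (f x) = x" and fg: "f (?g x) = x" for x
    using bij by (simp_all add: bij_is_inj bij_is_surj surj_f_inv_f)
  have g: "orthogonal_transformation ?g" using f by (rule orthogonal_transformation_inv)
  have lin: "linear f" "linear ?g" using f g by (auto simp: orthogonal_transformation_def)
  have [measurable]: "f \<in> borel_measurable borel" "?g \<in> borel_measurable borel"
    using lin by (auto intro!: borel_measurable_continuous_onI linear_continuous_on
        simp: linear_conv_bounded_linear)
  have sets_N [simp, measurable_cong]: "sets N = sets borel" by (simp add: N_def)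
  have space_N [simp]: "space N = UNIV" by (simp add: N_def)
  have "distr N lborel ?g = distr lborel lborel (\<lambda>x. x)"
    unfolding N_def by (subst distr_distr) (auto simp: comp_def gf)
  then have "distr N lborel ?g = lborel"
    by (simp add: distr_id2)
  \<comment> \<open>Fubini for \<open>N\<close> requires sigma-finiteness, which is pulled back from Lebesgue measure along the inverse map.\<close>
  then have "sigma_finite_measure N"
    using sigma_finite_lborel by (intro sigma_finite_measure_distr[of N lborel ?g]) auto
  then interpret N: sigma_finite_measure N .
  interpret P: pair_sigma_finite N lborel ..
  have shift_N: "distr N borel ((+) c) = N" for c
  proof -
    have "f (?g c + x) = c + f x" for x
      using lin(1) fg by (simp add: linear_add)
    then have "distr N borel ((+) c) = distr (distr lborel borel ((+) (?g c))) borel f"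
      unfolding N_def by (simp add: distr_distr comp_def)
    then show ?thesis by (simp add: lborel_distr_plus N_def)
  qed
  define b where "b = emeasure lborel (ball (0::'a) 1)"
  have ball_N: "emeasure N (ball y 1) = b" for y
  proof -
    have "f -` ball y 1 = ball (?g y) 1"
    proof -
      have "dist y (f x) = dist (?g y) x" for x
        using f[unfolded orthogonal_transformation_isometry] fg by metis
      then show ?thesis by auto
    qed
    then show ?thesis
      by (simp add: N_def emeasure_distr b_def emeasure_ball)
  qed
  have b: "b \<noteq> 0" "b \<noteq> \<infinity>"
    using content_ball_pos[of 1 "0::'a"] emeasure_lborel_ball_finite[of "0::'a" 1]
    by (auto simp: b_def measure_def)
  have "emeasure N A = emeasure lborel A" if A [measurable]: "A \<in> sets borel" for A
  proof -
    let ?B = "ball (0::'a) 1"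
    have [measurable]: "?B \<in> sets borel" by simp
    have "emeasure N A * b = (\<integral>\<^sup>+y. (\<integral>\<^sup>+x. indicator A x * indicator ?B y \<partial>N) \<partial>lborel)"
      by (simp add: nn_integral_multc nn_integral_cmult_indicator b_def)
    also have "\<dots> = (\<integral>\<^sup>+y. (\<integral>\<^sup>+x. indicator A (y + x) * indicator ?B y \<partial>N) \<partial>lborel)"
    proof (rule nn_integral_cong)
      fix y
      show "(\<integral>\<^sup>+x. indicator A x * indicator ?B y \<partial>N) = (\<integral>\<^sup>+x. indicator A (y + x) * indicator ?B y \<partial>N)"
        by (subst shift_N[of y, symmetric], subst nn_integral_distr) auto
    qed
    also have "\<dots> = (\<integral>\<^sup>+x. (\<integral>\<^sup>+y. indicator A (y + x) * indicator ?B y \<partial>lborel) \<partial>N)"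
      by (rule P.Fubini') measurable
    also have "\<dots> = (\<integral>\<^sup>+x. (\<integral>\<^sup>+y. indicator A y * indicator ?B (y - x) \<partial>lborel) \<partial>N)"
    proof (rule nn_integral_cong)
      fix x
      have "(\<integral>\<^sup>+y. indicator A y * indicator ?B (y - x) \<partial>lborel)
          = (\<integral>\<^sup>+y. indicator A y * indicator ?B (y - x) \<partial>distr lborel borel ((+) x))"
        by (simp only: lborel_distr_plus)
      also have "\<dots> = (\<integral>\<^sup>+y. indicator A (x + y) * indicator ?B (x + y - x) \<partial>lborel)"
        by (rule nn_integral_distr) measurable
      finally show "(\<integral>\<^sup>+y. indicator A (y + x) * indicator ?B y \<partial>lborel)
          = (\<integral>\<^sup>+y. indicator A y * indicator ?B (y - x) \<partial>lborel)"
        by (simp add: add.commute)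
    qed
    also have "\<dots> = (\<integral>\<^sup>+y. (\<integral>\<^sup>+x. indicator A y * indicator ?B (y - x) \<partial>N) \<partial>lborel)"
      by (rule P.Fubini'[symmetric]) measurable
    also have "\<dots> = (\<integral>\<^sup>+y. indicator A y * b \<partial>lborel)"
    proof (rule nn_integral_cong)
      fix y
      have "indicator ?B (y - x) = (indicator (ball y 1) x :: ennreal)" for x
        by (simp add: indicator_def dist_norm norm_minus_commute)
      then have "(\<integral>\<^sup>+x. indicator A y * indicator ?B (y - x) \<partial>N)
          = (\<integral>\<^sup>+x. indicator A y * indicator (ball y 1) x \<partial>N)" by simp
      also have "\<dots> = indicator A y * b"
        by (subst nn_integral_cmult_indicator) (simp_all add: ball_N)
      finally show "(\<integral>\<^sup>+x. indicator A y * indicator ?B (y - x) \<partial>N) = indicator A y * b" .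
    qed
    also have "\<dots> = emeasure lborel A * b"
      by (simp add: nn_integral_multc)
    finally have "b * emeasure N A = b * emeasure lborel A"
      by (simp add: mult.commute)
    then show ?thesis
      using b by (simp add: ennreal_mult_cancel_left)
  qed
  then have "N = lborel" by (intro measure_eqI) auto
  then show ?thesis by (simp add: N_def)
qed

lemma sets_haar_L [simp]: "sets (haar_L \<mu>M) = sets (restrict_space borel grpL)"
  by (simp add: haar_L_def)

lemma space_haar_L [simp]: "space (haar_L \<mu>M) = grpL"
  by (simp add: haar_L_def space_restrict_space)

lemma measurable_unip_mult:
  fixes \<mu>M :: "('n::finite) mat2 measure"
  assumes "sets \<mu>M = sets (restrict_space borel grpM)"
  shows "(\<lambda>(x, k). unip x ** k) \<in> measurable (lborel \<Otimes>\<^sub>M \<mu>M) (restrict_space borel grpL)"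
proof -
  have space: "space \<mu>M = grpM"
    using sets_eq_imp_space_eq[OF assms] by (simp add: space_restrict_space)
  have "(\<lambda>k. k) \<in> measurable \<mu>M borel"
    using assms by (simp add: measurable_restrict_space1 cong: measurable_cong_sets)
  moreover have "unip \<in> borel_measurable borel"
    by (intro borel_measurable_continuous_onI continuous_intros)
  then have "(\<lambda>p. unip (fst p)) \<in> borel_measurable (lborel \<Otimes>\<^sub>M \<mu>M)"
    by (rule measurable_compose[rotated]) simp
  moreover have "snd \<in> borel_measurable ((lborel :: (real ^ 'n) measure) \<Otimes>\<^sub>M \<mu>M)"
    by (rule measurable_compose[OF measurable_snd \<open>(\<lambda>k. k) \<in> measurable \<mu>M borel\<close>])
  ultimately have "(\<lambda>p. unip (fst p) ** snd p) \<in> borel_measurable (lborel \<Otimes>\<^sub>M \<mu>M)"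
    by (intro borel_measurable_continuous_Pair[where H = "\<lambda>a b. a ** b"] continuous_intros)
  then show ?thesis
    by (auto simp: measurable_restrict_space2_iff case_prod_beta space_pair_measure space grpL_def)
qed

text \<open>
Because \<open>\<mu>M\<close> is a probability measure, the part of \<open>L\<close> over a set of translations has the Lebesgue
measure of this set.
\<close>

lemma emeasure_haar_L_strip:
  assumes haar: "haar_probability grpM \<mu>M" and F: "F \<in> sets borel"
  shows "{l \<in> grpL. shift_coordinate l \<in> F} \<in> sets (haar_L \<mu>M)"
    and "emeasure (haar_L \<mu>M) {l \<in> grpL. shift_coordinate l \<in> F} = emeasure lborel F"
proof -
  interpret prob_space \<mu>M using haar by (simp add: haar_probability_def)
  have sets: "sets \<mu>M = sets (restrict_space borel grpM)" and space: "space \<mu>M = grpM"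
    using haar by (auto simp: haar_probability_def)
  let ?D = "{l \<in> grpL. shift_coordinate l \<in> F}"
  have "shift_coordinate \<in> borel_measurable borel"
    by (intro borel_measurable_continuous_onI continuous_on_shift_coordinate)
  then have "shift_coordinate -` F \<in> sets borel"
    using F measurable_sets[of shift_coordinate borel borel F] by simp
  moreover have "?D = grpL \<inter> shift_coordinate -` F" by auto
  ultimately show D: "?D \<in> sets (haar_L \<mu>M)"
    by (auto simp: sets_restrict_space)
  have "emeasure (haar_L \<mu>M) ?D
      = emeasure (lborel \<Otimes>\<^sub>M \<mu>M) ((\<lambda>(x, k). unip x ** k) -` ?D \<inter> space (lborel \<Otimes>\<^sub>M \<mu>M))"
    using D unfolding haar_L_def by (intro emeasure_distr measurable_unip_mult sets) simp
  also have "(\<lambda>(x, k). unip x ** k) -` ?D \<inter> space (lborel \<Otimes>\<^sub>M \<mu>M) = F \<times> grpM"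
  proof -
    have "unip x ** k \<in> ?D \<longleftrightarrow> x \<in> F" if "k \<in> grpM" for x k
      using that shift_coordinate_unip[OF that, of x] by (auto simp: grpL_def)
    then show ?thesis by (auto simp: space_pair_measure space)
  qed
  also have "emeasure (lborel \<Otimes>\<^sub>M \<mu>M) (F \<times> grpM) = emeasure lborel F"
    using F emeasure_space_1 sets.top[of \<mu>M] by (simp add: emeasure_pair_measure_Times space)
  finally show "emeasure (haar_L \<mu>M) ?D = emeasure lborel F" .
qed

text \<open>
In the coordinates \<open>(x, k)\<close> left multiplication by \<open>unip y ** block_diag m\<close> is the product map
\<open>(x, k) \<mapsto> (y + m x, block_diag m ** k)\<close>. Its first factor is a Euclidean motion and its second
factor is a left translation of \<open>M\<close>.
\<close>

lemma haar_L_invariant: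
  assumes haar: "haar_probability grpM \<mu>M" and h: "h \<in> grpL"
  shows "(\<lambda>l. h ** l) \<in> measurable (haar_L \<mu>M) (haar_L \<mu>M)"
    and "distr (haar_L \<mu>M) (haar_L \<mu>M) (\<lambda>l. h ** l) = haar_L \<mu>M"
proof -
  interpret prob_space \<mu>M using haar by (simp add: haar_probability_def)
  have sets: "sets \<mu>M = sets (restrict_space borel grpM)" and space: "space \<mu>M = grpM"
    and inv: "\<And>k. k \<in> grpM \<Longrightarrow> distr \<mu>M \<mu>M (\<lambda>h. k ** h) = \<mu>M"
    using haar by (auto simp: haar_probability_def)
  have "(\<lambda>l. h ** l) \<in> measurable (restrict_space borel grpL) (restrict_space borel grpL)"
    using grpL_mult[OF h] 
    by (auto intro!: measurable_restrict_space3 borel_measurable_continuous_onI continuous_intros)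
  then show meas: "(\<lambda>l. h ** l) \<in> measurable (haar_L \<mu>M) (haar_L \<mu>M)"
    by (simp cong: measurable_cong_sets)
  obtain y m where h_eq: "h = unip y ** block_diag m" and m: "rotation_matrix m"
    using h by (auto simp: grpL_iff)
  have orth: "orthogonal_matrix m" using m by (simp add: rotation_matrix_def)
  have k: "block_diag m \<in> grpM" using m by (auto simp: grpM_iff)
  let ?P = "lborel \<Otimes>\<^sub>M \<mu>M"
  let ?f = "\<lambda>x. y + m *v x" and ?g = "\<lambda>k. block_diag m ** k"
  let ?\<phi> = "\<lambda>(x, k). unip x ** k" and ?T = "\<lambda>(x, k). (?f x, ?g k)"
  have f_meas: "?f \<in> measurable lborel lborel"
    by (simp, intro borel_measurable_continuous_onI continuous_intros)
  have m_meas: "(\<lambda>x. m *v x) \<in> measurable borel borel"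
    by (intro borel_measurable_continuous_onI continuous_intros)
  have f_inv: "distr lborel lborel ?f = lborel"
  proof -
    have "distr lborel borel (\<lambda>x. m *v x) = lborel"
      by (rule lborel_distr_orthogonal)
         (use orth in \<open>simp add: orthogonal_transformation_matrix\<close>)
    then have "lborel = distr (distr lborel borel (\<lambda>x. m *v x)) borel ((+) y)"
      by (simp add: lborel_distr_plus)
    also have "\<dots> = distr lborel borel ?f"
      using m_meas by (simp add: distr_distr comp_def)
    also have "\<dots> = distr lborel lborel ?f" by (rule distr_cong) simp_all
    finally show ?thesis by simp
  qed
  have g_meas: "?g \<in> measurable \<mu>M \<mu>M"
  proof -
    have "?g \<in> measurable (restrict_space borel grpM) (restrict_space borel grpM)"
      using grpM_mult[OF k] 
      by (auto intro!: measurable_restrict_space3 borel_measurable_continuous_onI continuous_intros)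
    then show ?thesis using sets by (simp cong: measurable_cong_sets)
  qed
  have T_meas: "?T \<in> measurable ?P ?P"
    using f_meas g_meas by (simp add: measurable_split_conv case_prod_beta)
  have T_inv: "distr ?P ?P ?T = ?P"
    using pair_measure_distr[OF f_meas g_meas] prob_space_axioms
    by (simp add: f_inv inv[OF k] prob_space_imp_sigma_finite)
  note \<phi>_meas = measurable_unip_mult[OF sets]
  have "distr (haar_L \<mu>M) (haar_L \<mu>M) (\<lambda>l. h ** l) = distr ?P (haar_L \<mu>M) ((\<lambda>l. h ** l) \<circ> ?\<phi>)"
    unfolding haar_L_def[of \<mu>M]
    by (rule distr_distr) (use meas \<phi>_meas in \<open>simp_all cong: measurable_cong_sets\<close>)
  also have "\<dots> = distr ?P (restrict_space borel grpL) (?\<phi> \<circ> ?T)"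
    by (rule distr_cong) (auto simp: h_eq unip_block_mult[OF orth])
  also have "\<dots> = distr (distr ?P ?P ?T) (restrict_space borel grpL) ?\<phi>"
    by (rule distr_distr[symmetric, OF \<phi>_meas T_meas])
  also have "\<dots> = haar_L \<mu>M" by (simp only: T_inv haar_L_def)
  finally show "distr (haar_L \<mu>M) (haar_L \<mu>M) (\<lambda>l. h ** l) = haar_L \<mu>M" .
qed

lemma matrix_action_haar_L:
  assumes haar: "haar_probability grpM \<mu>M" and H: "H \<subseteq> grpL" "countable H" "mat 1 \<in> H"
    "\<And>h k. h \<in> H \<Longrightarrow> k \<in> H \<Longrightarrow> h ** k \<in> H" "\<And>h. h \<in> H \<Longrightarrow> matrix_inv h \<in> H"
  shows "matrix_action (haar_L \<mu>M) H"
proof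
  fix h assume h: "h \<in> H"
  then have hL: "h \<in> grpL" using H by auto
  show "matrix_inv h ** h = mat 1"
    by (rule form_preserving_inv(3)[OF grpL_form_preserving[OF hL]])
  show "(\<lambda>l. h ** l) \<in> measurable (haar_L \<mu>M) (haar_L \<mu>M)"
    "distr (haar_L \<mu>M) (haar_L \<mu>M) (\<lambda>l. h ** l) = haar_L \<mu>M"
    by (rule haar_L_invariant[OF haar hL])+
  fix l assume l: "l \<in> space (haar_L \<mu>M)" "h ** l = l"
  have "l ** matrix_inv l = mat 1"
    by (rule form_preserving_inv(2)[OF grpL_form_preserving]) (use l in simp)
  then show "h = mat 1"
    using l(2) by (metis matrix_mul_assoc matrix_mul_rid)
qed (use H in auto)

section \<open>Integral elements of the parabolic subgroup of a primitive vector\<close>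

lemma vector_matrix_Ints:
  fixes h :: "('n::finite) mat2"
  assumes "\<And>i. u $ i \<in> \<int>" "\<And>i j. h $ i $ j \<in> \<int>"
  shows "(u v* h) $ j \<in> \<int>"
  using assms by (auto simp: vector_matrix_mult_def)

lemma form_Ints:
  assumes "\<And>i. u $ i \<in> \<int>" "\<And>i. w $ i \<in> \<int>"
  shows "form u w \<in> \<int>"
  unfolding form_split using assms by (auto intro!: Ints_add Ints_diff Ints_sum Ints_mult)

text \<open>
The last conclusion expresses primitivity: a real multiple of \<open>v\<close> can be integral only if the factor
is an integer.
\<close>

lemma primitive_cone_plusD:
  assumes "v \<in> primitive_cone_plus"
  shows "v $ i \<in> \<int>" "v $ Back > 0" "form v v = 0"
    "(\<And>i. c * v $ i \<in> \<int>) \<Longrightarrow> c \<in> \<int>"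
proof -
  obtain w :: "int ^ 'a idx" where w: "v = (\<chi> j. of_int (w $ j))" "Gcd (range (($) w)) = 1"
    using assms by (auto simp: primitive_cone_plus_def)
  show "v $ i \<in> \<int>" by (simp add: w)
  show pos: "v $ Back > 0" and "form v v = 0"
    using assms by (auto simp: primitive_cone_plus_def cone_plus_def quadQ_form)
  assume c: "\<And>i. c * v $ i \<in> \<int>"
  then have "\<forall>i. \<exists>n. c * v $ i = of_int n" by (meson Ints_cases)
  then obtain n where n: "\<And>i. c * v $ i = of_int (n i)" by metis
  \<comment> \<open>Since \<open>c = n Back / w $ Back\<close>, it is to be shown that \<open>w $ Back\<close> divides \<open>n Back\<close>, the gcd of all \<open>n Back * w $ i\<close>.\<close>
  have cross: "w $ Back * n i = n Back * w $ i" for i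
  proof -
    have "real_of_int (w $ Back * n i) = real_of_int (n Back * w $ i)"
      using n[of i] n[of Back] by (simp add: w(1)) (metis mult.assoc mult.commute)
    then show ?thesis by linarith
  qed
  have "w $ Back dvd Gcd ((*) (n Back) ` range (($) w))"
  proof (rule Gcd_greatest)
    fix b assume "b \<in> (*) (n Back) ` range (($) w)"
    then obtain i where "b = n Back * w $ i" by auto
    then show "w $ Back dvd b" by (metis cross dvd_triv_left)
  qed
  then have "w $ Back dvd n Back" by (simp add: Gcd_mult w(2))
  then obtain t where "n Back = w $ Back * t" by (auto simp: dvd_def)
  then have "c = of_int t"
    using n[of Back] pos by (simp add: w(1))
  then show "c \<in> \<int>" by simp
qed

text \<open>
An integral matrix fixing the ray of \<open>v\<close> multiplies \<open>v\<close> by some \<open>c > 0\<close>. Since \<open>v\<close> is primitive and the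
inverse matrix is integral too, both \<open>c\<close> and \<open>1 / c\<close> are integers.
\<close>

lemma integral_parabolic_fixes_vector:
  assumes v: "v \<in> primitive_cone_plus" and h: "h \<in> SOQ_plus_int \<inter> parabolic_of v"
  shows "v v* h = v"
proof -
  have "v \<in> ray v" by (auto simp: ray_def intro!: exI[of _ 1])
  then have "v v* h \<in> ray v" using h by (auto simp: parabolic_of_def)
  then obtain c where c: "c > 0" "v v* h = c *\<^sub>R v" by (auto simp: ray_def)
  have "form_preserving h"
    using h SOQ_plus_SOQ by (auto simp: SOQ_plus_int_def SOQ_iff)
  then have "c *\<^sub>R (v v* matrix_inv h) = v"
    using c(2) by (metis form_preserving_inv(2) scaleR_vector_matrix_assoc vector_matrix_mul_assoc vector_matrix_mul_rid)
  then have c': "v v* matrix_inv h = (1 / c) *\<^sub>R v"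
    using c(1) by (metis divide_inverse mult_1 scaleR_scaleR scaleR_one left_inverse less_irrefl)
  have int: "(v v* k) $ i \<in> \<int>" if "k \<in> SOQ_plus_int" for k i
    using that by (intro vector_matrix_Ints primitive_cone_plusD(1)[OF v]) (auto simp: SOQ_plus_int_def)
  have "c \<in> \<int>"
    by (rule primitive_cone_plusD(4)[OF v]) (use int[of h] h c(2) in auto)
  moreover have "1 / c \<in> \<int>"
    by (rule primitive_cone_plusD(4)[OF v]) (use int[OF SOQ_plus_int_inv, of h] h c' in auto)
  ultimately obtain a b where "c = of_int a" "1 / c = of_int b" by (auto elim!: Ints_cases)
  then have "real_of_int (a * b) = 1" using c(1) by (simp add: field_simps)
  then have "a * b = 1" by linarith
  moreover have "a > 0" using c(1) \<open>c = of_int a\<close> by simp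
  ultimately have "a = 1" by (simp add: zmult_eq_1_iff)
  then show ?thesis using c(2) \<open>c = of_int a\<close> by simp
qed

text \<open>
The vectors \<open>v\<close> and \<open>v $ Back *\<^sub>R e0\<close> have equal \<open>form\<close>-length (both are isotropic) and the same last
coordinate. The reflection in their difference \<open>d\<close> exchanges them, and it is rational because \<open>d\<close> is
integral. If they coincide, the identity does the same. So over the
rationals the cusp of \<open>v\<close> looks like the standard cusp of \<open>e0\<close>.
\<close>

lemma rational_reflection:
  fixes v :: "('n::finite) vec2"
  assumes v: "\<And>i. v $ i \<in> \<int>" "v $ Back > 0" "form v v = 0"
  obtains r :: "'n mat2" and N :: nat
  where "form_preserving r" "e0 v* r = (1 / v $ Back) *\<^sub>R v" "N > 0" "\<And>i j. of_nat N * r $ i $ j \<in> \<int>"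
proof (cases "v = v $ Back *\<^sub>R e0")
  case True
  then have "(1 / v $ Back) *\<^sub>R v = (1 / v $ Back) *\<^sub>R (v $ Back *\<^sub>R e0)" by simp
  then have "e0 = (1 / v $ Back) *\<^sub>R v" using v(2) by simp
  then show ?thesis
    by (intro that[of "mat 1" 1] form_preserving_mat_1) (simp_all add: mat_component)
next
  case False
  define d where "d = v - v $ Back *\<^sub>R e0"
  define D where "D = form d d"
  have d_int: "d $ i \<in> \<int>" for i
    unfolding d_def using v(1) by (cases i) (auto intro!: Ints_diff Ints_mult)
  have "d \<noteq> 0" using False by (simp add: d_def)
  have D_sum: "D = d $ Front * d $ Front + (\<Sum>a\<in>UNIV. d $ Mid a * d $ Mid a)"
    by (simp add: D_def form_split d_def)
  have "D \<noteq> 0"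
  proof
    assume "D = 0"
    moreover have "0 \<le> (\<Sum>a\<in>UNIV. d $ Mid a * d $ Mid a)" by (intro sum_nonneg) simp
    moreover have "0 \<le> d $ Front * d $ Front" by simp
    ultimately have "d $ Front * d $ Front = 0" "(\<Sum>a\<in>UNIV. d $ Mid a * d $ Mid a) = 0"
      unfolding D_sum by linarith+
    then have "d = 0"
      by (intro vec_idx_eqI) (simp_all add: sum_nonneg_eq_0_iff d_def)
    with \<open>d \<noteq> 0\<close> show False by simp
  qed
  have "D \<ge> 0" unfolding D_sum by (intro add_nonneg_nonneg sum_nonneg) simp_all
  have "D \<in> \<int>" unfolding D_def by (intro form_Ints d_int)
  then obtain N' where N': "D = of_int N'" by (auto elim: Ints_cases)
  \<comment> \<open>The matrix of the reflection \<open>u \<mapsto> u - (2 form u d / form d d) d\<close>, acting from the right.\<close>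
  define r where "r = (\<chi> i j. (if i = j then 1 else 0) - 2 * signature i * d $ i * d $ j / D)"
  have r: "u v* r = u - (2 * form u d / D) *\<^sub>R d" for u
  proof -
    have "(u v* r) $ j = u $ j - (2 * form u d / D) * d $ j" for j
    proof -
      have "(u v* r) $ j = (\<Sum>i\<in>UNIV. u $ i * (if i = j then 1 else 0))
          - (\<Sum>i\<in>UNIV. signature i * (u $ i * d $ i) * (2 * d $ j / D))"
        by (simp add: vector_matrix_mult_def r_def right_diff_distrib sum_subtractf mult_ac)
      also have "(\<Sum>i\<in>UNIV. u $ i * (if i = j then 1 else 0)) = u $ j"
        by (simp add: if_distrib cong: if_cong)
      also have "(\<Sum>i\<in>UNIV. signature i * (u $ i * d $ i) * (2 * d $ j / D)) = (2 * form u d / D) * d $ j"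
        unfolding form_def sum_distrib_right[symmetric] by simp
      finally show ?thesis .
    qed
    then show ?thesis by (simp add: vec_eq_iff)
  qed
  have "form (u v* r) (w v* r) = form u w" for u w
    using \<open>D \<noteq> 0\<close>
    by (simp add: r form_linear D_def[symmetric] form_commute[of d u] form_commute[of d w] field_simps)
  then have 1: "form_preserving r" by (simp add: form_preserving_def)
  have "form e0 d = form e0 v" by (simp add: d_def form_linear form_e0_e0)
  moreover have "D = - 2 * v $ Back * form e0 v"
    by (simp add: D_def d_def form_linear form_e0_e0 v(3) form_commute[of v e0])
  ultimately have "2 * form e0 d / D = - 1 / v $ Back"
    using \<open>D \<noteq> 0\<close> v(2) by (auto simp: field_simps)
  then have "e0 v* r = e0 + (1 / v $ Back) *\<^sub>R d" by (simp add: r)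
  also have "\<dots> = (1 / v $ Back) *\<^sub>R v" using v(2) by (simp add: d_def scaleR_diff_right)
  finally have 2: "e0 v* r = (1 / v $ Back) *\<^sub>R v" .
  have "N' > 0" using N' \<open>D \<noteq> 0\<close> \<open>D \<ge> 0\<close> by simp
  then have N: "of_nat (nat N') = D" using N' by simp
  have 3: "of_nat (nat N') * r $ i $ j \<in> \<int>" for i j
  proof -
    have "D * r $ i $ j = D * (if i = j then 1 else 0) - 2 * signature i * d $ i * d $ j"
      using \<open>D \<noteq> 0\<close> by (simp add: r_def algebra_simps)
    also have "\<dots> \<in> \<int>" using d_int \<open>D \<in> \<int>\<close> by (auto simp: signature_def intro!: Ints_diff Ints_mult)
    finally show ?thesis by (simp add: N)
  qed
  show ?thesis using that[OF 1 2 _ 3] \<open>N' > 0\<close> by simp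
qed

text \<open>
The transvection formula \<open>vector_unip\<close> transported by \<open>g\<close>. The vector \<open>mid x v* matrix_inv g\<close> need not be
rational, but the transvection depends on it only modulo \<open>v\<close>, so any \<open>w\<close> congruent to it may be used.
\<close>

lemma conjugate_unip_action:
  assumes g: "form_preserving g" and v: "v = e0 v* matrix_inv g"
    and w: "mid x v* matrix_inv g = w + c *\<^sub>R v"
  shows "u v* (g ** unip x ** matrix_inv g)
    = u - form u v *\<^sub>R w + (form u w - form u v * (x \<bullet> x) / 2) *\<^sub>R v"
proof -
  have adj: "form (u v* g) y = form u (y v* matrix_inv g)" for y
    using form_preservingD[OF g, of u "y v* matrix_inv g"]
    by (simp add: vector_matrix_mul_assoc form_preserving_inv(2,3)[OF g])
  have "u v* (g ** unip x ** matrix_inv g) = ((u v* g) v* unip x) v* matrix_inv g"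
    by (simp add: vector_matrix_mul_assoc matrix_mul_assoc)
  also have "\<dots> = u - form u v *\<^sub>R (w + c *\<^sub>R v)
      + (form u (w + c *\<^sub>R v) - form u v * (x \<bullet> x) / 2) *\<^sub>R v"
    by (simp add: vector_unip vector_matrix_left_distrib vector_matrix_mult_diff_distrib
        scaleR_vector_matrix_assoc adj w v[symmetric])
       (simp add: vector_matrix_mul_assoc form_preserving_inv(2,3)[OF g])
  finally show ?thesis
    by (simp add: form_linear algebra_simps)
qed

text \<open>
The one-parameter group \<open>g u\<^sub>t\<^sub>x g\<^sup>-\<^sup>1\<close> joins the element to the identity inside \<open>SOQ\<close>.
\<close>

lemma conjugate_unip_SOQ_plus:
  assumes g: "g \<in> SOQ"
  shows "g ** unip x ** matrix_inv g \<in> SOQ_plus"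
proof -
  let ?\<gamma> = "\<lambda>t::real. g ** unip (t *\<^sub>R x) ** matrix_inv g"
  have "connected (range ?\<gamma>)"
    by (intro connected_continuous_image continuous_intros connected_UNIV)
  moreover have "range ?\<gamma> \<subseteq> SOQ"
    using g by (auto intro!: SOQ_mult SOQ_inv unip_SOQ)
  moreover have "mat 1 \<in> range ?\<gamma>"
  proof
    have "g ** matrix_inv g = mat 1" using g form_preserving_inv(2) SOQ_iff by blast
    then show "mat 1 = ?\<gamma> 0" by (simp add: unip_0)
  qed simp
  moreover have "g ** unip x ** matrix_inv g \<in> range ?\<gamma>" by (rule range_eqI[of _ _ 1]) simp
  ultimately have "connected_component SOQ (mat 1) (g ** unip x ** matrix_inv g)"
    unfolding connected_component_def by blast
  then show ?thesis by (simp add: SOQ_plus_def)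
qed

text \<open>
This is where arithmetic enters. Compare \<open>g\<close> with the rational reflection \<open>r\<close> for \<open>v\<close>: the product
\<open>k = r ** g\<close> preserves the line of \<open>e0\<close>, hence has an orthogonal middle block \<open>m\<close>. For \<open>x = z v* m\<close> the vector
\<open>mid x v* matrix_inv g\<close> is congruent to \<open>mid z v* r\<close> modulo \<open>v\<close>. For \<open>z\<close> in a suitable cubic lattice
\<open>w = mid z v* r\<close> is integral of even norm, and then \<open>conjugate_unip_action\<close> shows that the transvection
is an integral matrix. Because \<open>m\<close> is orthogonal, these \<open>x\<close> form an isometric copy of a cubic lattice.
\<close>

lemma cusp_contains_cubic_lattice:
  fixes g :: "('n::finite) mat2"
  assumes v: "v \<in> primitive_cone_plus" and g: "g \<in> SOQ_plus" and ve: "v = e0 v* matrix_inv g"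
  obtains m :: "real ^ 'n ^ 'n" and N :: nat where "orthogonal_matrix m" "N > 0"
    "\<And>z. (\<And>a. z $ a \<in> \<int>) \<Longrightarrow>
      unip ((real N *\<^sub>R z) v* m) \<in> conjugate g (SOQ_plus_int \<inter> parabolic_of v)"
proof -
  note vD = primitive_cone_plusD[OF v]
  have gS: "g \<in> SOQ" using g by (rule SOQ_plus_SOQ)
  then have gp: "form_preserving g" by (simp add: SOQ_iff)
  have vg: "v v* g = e0"
    by (simp add: ve vector_matrix_mul_assoc form_preserving_inv(2,3)[OF gp])
  obtain r :: "'n mat2" and N :: nat where r: "form_preserving r" "e0 v* r = (1 / v $ Back) *\<^sub>R v" "N > 0"
    "\<And>i j. of_nat N * r $ i $ j \<in> \<int>"
    using rational_reflection[of v] vD by metis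
  define k where "k = r ** g"
  define m where "m = (\<chi> a b. k $ Mid a $ Mid b)"
  have kp: "form_preserving k" unfolding k_def using r(1) gp by (rule form_preserving_mult)
  have ke: "e0 v* k = (1 / v $ Back) *\<^sub>R e0"
    by (simp add: k_def vector_matrix_mul_assoc[symmetric] r(2) scaleR_vector_matrix_assoc vg)
  have "1 / v $ Back \<noteq> 0" using vD(2) by simp
  note block = scaling_e0_mid_block[OF kp ke this]
  have orth: "orthogonal_matrix m" using block(2) by (simp add: m_def)
  have lift: "mid (z v* m) v* matrix_inv g = mid z v* r + (- (mid z v* k) $ Back) *\<^sub>R v" for z
  proof -
    have "mid z v* k = mid (z v* m) + ((mid z v* k) $ Back) *\<^sub>R e0"
      by (rule vec_idx_eqI)
         (simp_all add: vector_matrix_mult_def sum_idx block(1) m_def sum_negf)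
    then have "mid (z v* m) = mid z v* k + (- (mid z v* k) $ Back) *\<^sub>R e0"
      by (simp add: algebra_simps)
    then have "mid (z v* m) v* matrix_inv g
        = (mid z v* k) v* matrix_inv g + (- (mid z v* k) $ Back) *\<^sub>R (e0 v* matrix_inv g)"
      by (simp only: vector_matrix_left_distrib scaleR_vector_matrix_assoc)
    also have "(mid z v* k) v* matrix_inv g = mid z v* r"
      by (simp add: k_def vector_matrix_mul_assoc matrix_mul_assoc[symmetric] form_preserving_inv(2,3)[OF gp])
    finally show ?thesis by (simp only: ve[symmetric])
  qed
  have "unip ((real (2 * N) *\<^sub>R z) v* m) \<in> conjugate g (SOQ_plus_int \<inter> parabolic_of v)"
    if z: "\<And>a. z $ a \<in> \<int>" for z
  proof -
    \<comment> \<open>The factor \<open>2\<close> makes the norm of \<open>w\<close> even, which cancels the denominator in the transvection.\<close>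
    define z' where "z' = real (2 * N) *\<^sub>R z"
    define w where "w = mid z' v* r"
    let ?x = "z' v* m"
    define \<gamma> where "\<gamma> = g ** unip ?x ** matrix_inv g"
    have w_int: "w $ j \<in> \<int>" for j
    proof -
      have "w $ j = (\<Sum>a\<in>UNIV. 2 * z $ a * (of_nat N * r $ Mid a $ j))"
        by (simp add: w_def z'_def vector_matrix_mult_def sum_idx mult_ac)
      also have "\<dots> \<in> \<int>" by (intro Ints_sum Ints_mult[OF Ints_mult] r(4) z) simp
      finally show ?thesis .
    qed
    have half_int: "(?x \<bullet> ?x) / 2 \<in> \<int>"
    proof -
      have "?x \<bullet> ?x = z' \<bullet> z'"
        using orthogonal_matrix_cancel(4)[OF orth, of z'] by (simp add: norm_eq)
      then have "(?x \<bullet> ?x) / 2 = 2 * of_nat N * of_nat N * (\<Sum>a\<in>UNIV. z $ a * z $ a)"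
        by (simp add: z'_def inner_vec_def sum_distrib_left mult_ac)
      also have "\<dots> \<in> \<int>" using z by (intro Ints_mult Ints_sum) auto
      finally show ?thesis .
    qed
    have "\<gamma> $ i $ j \<in> \<int>" for i j
    proof -
      let ?e = "axis i 1 :: 'n vec2"
      have e: "?e $ l \<in> \<int>" for l by (simp add: axis_def)
      have "\<gamma> $ i = ?e - form ?e v *\<^sub>R w + (form ?e w - form ?e v * (?x \<bullet> ?x) / 2) *\<^sub>R v"
        using conjugate_unip_action[OF gp ve lift[of z'], of ?e]
        by (simp only: \<gamma>_def axis_vector_matrix w_def)
      then have "\<gamma> $ i $ j = ?e $ j - form ?e v * w $ j + (form ?e w - form ?e v * ((?x \<bullet> ?x) / 2)) * v $ j"
        by simp
      also have "\<dots> \<in> \<int>"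
        by (intro Ints_add Ints_diff Ints_mult form_Ints half_int w_int vD(1) e)
      finally show ?thesis .
    qed
    moreover have "\<gamma> \<in> SOQ_plus" unfolding \<gamma>_def by (rule conjugate_unip_SOQ_plus[OF gS])
    ultimately have "\<gamma> \<in> SOQ_plus_int" by (simp add: SOQ_plus_int_def)
    moreover have "\<gamma> \<in> parabolic_of v"
    proof -
      have "e0 v* unip ?x = e0" by (simp add: vector_unip form_e0_e0 form_mid_e0)
      then have "v v* \<gamma> = v"
        unfolding \<gamma>_def by (metis ve vg vector_matrix_mul_assoc)
      then have "u v* \<gamma> = u" if "u \<in> ray v" for u
        using that by (auto simp: ray_def scaleR_vector_matrix_assoc)
      then show ?thesis using \<open>\<gamma> \<in> SOQ_plus\<close> by (simp add: parabolic_of_def)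
    qed
    moreover have "unip ?x = matrix_inv g ** \<gamma> ** g"
    proof -
      have "matrix_inv g ** \<gamma> ** g = (matrix_inv g ** g) ** unip ?x ** (matrix_inv g ** g)"
        by (simp only: \<gamma>_def matrix_mul_assoc)
      then show ?thesis by (simp add: form_preserving_inv(2,3)[OF gp])
    qed
    ultimately show ?thesis unfolding conjugate_def z'_def by blast
  qed
  then show ?thesis using that[OF orth, of "2 * N"] r(3) by simp
qed

section \<open>The covolume of a cusp group\<close>

text \<open>
Write \<open>a\<close> and \<open>b = h ** a\<close> for two points of one orbit. Then \<open>h = b a\<^sup>-\<^sup>1\<close> depends continuously on \<open>(a, b)\<close>,
and it is close to the identity when \<open>a\<close> and \<open>b\<close> are both close to \<open>l\<close>. Conjugating back by \<open>g\<close> gives an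
integral matrix with entries at distance less than \<open>1\<close> from those of the identity.
\<close>

lemma conjugate_integral_wandering:
  fixes g :: "('n::finite) mat2"
  assumes g: "form_preserving g" and \<Gamma>: "\<And>\<gamma> i j. \<gamma> \<in> \<Gamma> \<Longrightarrow> \<gamma> $ i $ j \<in> \<int>" and l: "l \<in> grpL"
  shows "\<exists>B. open B \<and> l \<in> B \<and> (\<forall>h\<in>conjugate g \<Gamma>. \<forall>a\<in>B \<inter> grpL. h ** a \<in> B \<longrightarrow> h = mat 1)"
proof -
  let ?F = "\<lambda>p. g ** (snd p ** form_adjoint (fst p)) ** matrix_inv g"
  let ?one = "mat 1 :: 'n mat2"
  define W where "W = (\<Inter>i. \<Inter>j. {p. \<bar>?F p $ i $ j - ?one $ i $ j\<bar> < 1})"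
  have gg: "g ** matrix_inv g = mat 1" "matrix_inv g ** g = mat 1"
    by (rule form_preserving_inv(2,3)[OF g])+
  have "open W"
    unfolding W_def by (intro open_INT ballI finite open_Collect_less continuous_intros)
  moreover have "(l, l) \<in> W"
    using form_adjoint_inverse(1)[OF grpL_form_preserving[OF l]] by (simp add: W_def gg)
  ultimately obtain A B where AB: "open A" "open B" "l \<in> A" "l \<in> B" "A \<times> B \<subseteq> W"
    by (auto elim!: open_prod_elim)
  have "h = mat 1" if h: "h \<in> conjugate g \<Gamma>" and a: "a \<in> A \<inter> B \<inter> grpL" "h ** a \<in> A \<inter> B" for h a
  proof -
    obtain \<gamma> where \<gamma>: "\<gamma> \<in> \<Gamma>" "h = matrix_inv g ** \<gamma> ** g" using h by (auto simp: conjugate_def)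
    have "(a, h ** a) \<in> W" using AB a by auto
    moreover have "?F (a, h ** a) = \<gamma>"
    proof -
      have "?F (a, h ** a) = g ** h ** (a ** form_adjoint a) ** matrix_inv g"
        by (simp add: matrix_mul_assoc)
      also have "a ** form_adjoint a = mat 1"
        using a by (intro form_adjoint_inverse grpL_form_preserving) simp
      also have "g ** h ** mat 1 ** matrix_inv g = (g ** matrix_inv g) ** \<gamma> ** (g ** matrix_inv g)"
        by (simp only: \<gamma>(2) matrix_mul_assoc matrix_mul_rid)
      finally show ?thesis by (simp add: gg)
    qed
    ultimately have close: "\<bar>\<gamma> $ i $ j - ?one $ i $ j\<bar> < 1" for i j
      unfolding W_def by auto
    have "\<gamma> $ i $ j = ?one $ i $ j" for i j
    proof -
      have "\<gamma> $ i $ j - ?one $ i $ j \<in> \<int>" using \<Gamma>[OF \<gamma>(1), of i j] by (simp add: mat_component)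
      then obtain n where n: "\<gamma> $ i $ j - ?one $ i $ j = of_int n" by (auto elim: Ints_cases)
      then have "n = 0" using close[of i j] by simp
      with n show ?thesis by simp
    qed
    then have "\<gamma> = mat 1" by (simp add: vec_eq_iff)
    then show ?thesis by (simp add: \<gamma>(2) gg)
  qed
  with AB show ?thesis by (intro exI[of _ "A \<inter> B"]) auto
qed

lemma countable_integral_matrices:
  "countable {h :: ('n::finite) mat2. \<forall>i j. h $ i $ j \<in> \<int>}"
proof (rule countable_subset)
  show "{h :: 'n mat2. \<forall>i j. h $ i $ j \<in> \<int>}
      \<subseteq> (\<lambda>f. \<chi> i j. f (i, j)) ` (UNIV \<rightarrow>\<^sub>E (\<int> :: real set))"
  proof
    fix h :: "'n mat2" assume "h \<in> {h. \<forall>i j. h $ i $ j \<in> \<int>}"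
    then show "h \<in> (\<lambda>f. \<chi> i j. f (i, j)) ` (UNIV \<rightarrow>\<^sub>E (\<int> :: real set))"
      by (intro image_eqI[of _ _ "\<lambda>(i, j). h $ i $ j"]) (auto simp: vec_eq_iff)
  qed
  show "countable ((\<lambda>f. \<chi> i j. f (i, j)) ` ((UNIV :: ('n idx \<times> 'n idx) set) \<rightarrow>\<^sub>E (\<int> :: real set)) :: 'n mat2 set)"
    by (intro countable_image countable_PiE countable_int) simp
qed

lemma emeasure_half_open_cube:
  fixes N :: real
  assumes "N > 0"
  shows "{y :: real ^ 'n::finite. \<forall>a. 0 \<le> y $ a \<and> y $ a < N} \<in> sets borel"
    and "emeasure lborel {y :: real ^ 'n. \<forall>a. 0 \<le> y $ a \<and> y $ a < N} = ennreal (N ^ CARD('n))"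
proof -
  let ?C = "{y :: real ^ 'n. \<forall>a. 0 \<le> y $ a \<and> y $ a < N}"
  let ?u = "\<chi> a. N :: real ^ 'n"
  have "?C = (\<Inter>a. {y. 0 \<le> y $ a} \<inter> {y. y $ a < N})" by auto
  moreover have "{y :: real ^ 'n. 0 \<le> y $ a} \<inter> {y. y $ a < N} \<in> sets borel" for a
    by (intro sets.Int borel_closed borel_open closed_Collect_le open_Collect_less continuous_intros)
  ultimately show C: "?C \<in> sets borel" by (simp only:) (intro sets.finite_INT; simp)
  have prod: "(\<Prod>b\<in>Basis. (?u - 0) \<bullet> b) = N ^ CARD('n)"
  proof -
    have "(\<Prod>b\<in>Basis. (?u - 0) \<bullet> b) = (\<Prod>b\<in>(Basis :: (real ^ 'n) set). N)"
      by (intro prod.cong) (auto simp: Basis_vec_def inner_axis)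
    then show ?thesis by simp
  qed
  have le: "0 \<bullet> b \<le> ?u \<bullet> b" if "b \<in> Basis" for b
    using that assms by (auto simp: Basis_vec_def inner_axis)
  have "emeasure lborel (box 0 ?u) \<le> emeasure lborel ?C"
    using C by (intro emeasure_mono) (auto simp: mem_box_cart less_imp_le)
  moreover have "emeasure lborel ?C \<le> emeasure lborel (cbox 0 ?u)"
    by (intro emeasure_mono) (auto simp: mem_box_cart less_imp_le)
  moreover have "emeasure lborel (box 0 ?u) = ennreal (N ^ CARD('n))"
    using le prod by (subst emeasure_lborel_box) auto
  moreover have "emeasure lborel (cbox 0 ?u) = ennreal (N ^ CARD('n))"
    using le prod by (subst emeasure_lborel_cbox) auto
  ultimately show "emeasure lborel ?C = ennreal (N ^ CARD('n))" by simp
qed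

definition cubic_translations :: "real ^ 'n ^ 'n \<Rightarrow> real \<Rightarrow> ('n::finite) mat2 set" where
  "cubic_translations m N = {unip ((N *\<^sub>R z) v* m) | z. \<forall>a. z $ a \<in> \<int>}"

lemma cubic_translations_matrix_action:
  assumes haar: "haar_probability grpM \<mu>M" and H: "cubic_translations m N \<subseteq> H" "matrix_action \<mu> H" "H \<subseteq> grpL"
  shows "matrix_action (haar_L \<mu>M) (cubic_translations m N)"
proof (rule matrix_action_haar_L[OF haar])
  let ?K = "cubic_translations m N"
  have add: "(N *\<^sub>R (z + z')) v* m = (N *\<^sub>R z) v* m + (N *\<^sub>R z') v* m" for z z'
    by (simp add: scaleR_add_right vector_matrix_left_distrib)
  show "?K \<subseteq> grpL" using H by auto
  show "countable ?K" using H(1) matrix_action.countable[OF H(2)] by (rule countable_subset)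
  show "mat 1 \<in> ?K"
    unfolding cubic_translations_def by (intro CollectI exI[of _ 0]) (simp add: unip_0)
  fix h assume "h \<in> ?K"
  then obtain z where z: "h = unip ((N *\<^sub>R z) v* m)" "\<forall>a. z $ a \<in> \<int>" by (auto simp: cubic_translations_def)
  have "h ** unip ((N *\<^sub>R (- z)) v* m) = mat 1"
    using add[of z "- z"] by (simp add: z(1) unip_add unip_0)
  then have "matrix_inv h = unip ((N *\<^sub>R (- z)) v* m)" by (rule matrix_inv_eqI)
  then show "matrix_inv h \<in> ?K"
    unfolding cubic_translations_def using z(2) by (intro CollectI exI[of _ "- z"]) simp
  fix k assume "k \<in> ?K"
  then obtain z' where z': "k = unip ((N *\<^sub>R z') v* m)" "\<forall>a. z' $ a \<in> \<int>" by (auto simp: cubic_translations_def)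
  show "h ** k \<in> ?K"
    unfolding cubic_translations_def using z z' by (intro CollectI exI[of _ "z + z'"]) (simp add: unip_add add)
qed

text \<open>
The part of \<open>L\<close> over an isometric copy of the half-open cube of side \<open>N\<close> is a fundamental domain.
\<close>

lemma covolume_cubic_translations:
  fixes m :: "real ^ 'n ^ 'n::finite"
  assumes haar: "haar_probability grpM \<mu>M" and m: "orthogonal_matrix m" and N: "N > 0"
    and act: "matrix_action (haar_L \<mu>M) (cubic_translations m N)"
  shows "covolume (haar_L \<mu>M) (cubic_translations m N) = ennreal (N ^ CARD('n))"
proof -
  let ?K = "cubic_translations m N"
  interpret K: matrix_action "haar_L \<mu>M" ?K by fact
  define C :: "(real ^ 'n) set" where "C = {y. \<forall>a. 0 \<le> y $ a \<and> y $ a < N}"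
  define F where "F = {x. m *v x \<in> C}"
  define D where "D = {l \<in> grpL. shift_coordinate l \<in> F}"
  have C: "C \<in> sets borel" "emeasure lborel C = ennreal (N ^ CARD('n))"
    using emeasure_half_open_cube[OF N, where 'n = 'n] by (simp_all add: C_def)
  have m_meas: "(\<lambda>x. m *v x) \<in> measurable borel borel"
    by (intro borel_measurable_continuous_onI continuous_intros)
  have F_vimage: "F = (\<lambda>x. m *v x) -` C \<inter> space borel" by (auto simp: F_def)
  have F: "F \<in> sets borel" unfolding F_vimage using m_meas C(1) by (rule measurable_sets)
  have "distr lborel borel (\<lambda>x. m *v x) = lborel"
    by (rule lborel_distr_orthogonal) (use m in \<open>simp add: orthogonal_transformation_matrix\<close>)
  then have "emeasure lborel C = emeasure (distr lborel borel (\<lambda>x. m *v x)) C" by simp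
  also have "\<dots> = emeasure lborel F" using m_meas C(1) by (simp add: emeasure_distr F_vimage)
  finally have vol: "emeasure (haar_L \<mu>M) D = ennreal (N ^ CARD('n))"
    using emeasure_haar_L_strip(2)[OF haar F] C(2) by (simp add: D_def)
  have shift: "shift_coordinate (unip y ** l) = y + shift_coordinate l \<and> unip y ** l \<in> grpL" if lL: "l \<in> grpL" for y l
  proof -
    obtain x k where l: "l = unip x ** k" "k \<in> grpM" using lL by (auto simp: grpL_def)
    then have "unip y ** l = unip (y + x) ** k" by (simp add: matrix_mul_assoc unip_add)
    then show ?thesis using l by (auto simp: shift_coordinate_unip grpL_def)
  qed
  have mshift: "m *v ((N *\<^sub>R z) v* m + x) = N *\<^sub>R z + m *v x" for z x
    by (simp add: matrix_vector_right_distrib orthogonal_matrix_cancel(2)[OF m])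
  have "fundamental_domain (haar_L \<mu>M) ?K D"
  proof (rule K.fundamental_domainI)
    show "D \<in> sets (haar_L \<mu>M)" unfolding D_def by (rule emeasure_haar_L_strip(1)[OF haar F])
  next
    fix l assume "l \<in> space (haar_L \<mu>M)"
    then have l: "l \<in> grpL" by simp
    define t where "t = m *v shift_coordinate l"
    define z :: "real ^ 'n" where "z = (\<chi> a. - of_int \<lfloor>t $ a / N\<rfloor>)"
    let ?h = "unip ((N *\<^sub>R z) v* m)"
    have "?h \<in> ?K" unfolding cubic_translations_def by (intro CollectI exI[of _ z]) (simp add: z_def)
    moreover have "?h ** l \<in> D"
    proof -
      have "0 \<le> N * z $ a + t $ a \<and> N * z $ a + t $ a < N" for a
      proof -
        let ?s = "t $ a / N"
        have "N * of_int \<lfloor>?s\<rfloor> \<le> N * ?s"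
          using N by (intro mult_left_mono of_int_floor_le) simp
        moreover have "N * ?s < N * (of_int \<lfloor>?s\<rfloor> + 1)"
          using N floor_correct[of ?s] by (intro mult_strict_left_mono) simp_all
        moreover have "N * ?s = t $ a" using N by simp
        ultimately show ?thesis using N by (simp add: z_def algebra_simps)
      qed
      then have "N *\<^sub>R z + t \<in> C" by (simp add: C_def)
      then show ?thesis using shift[OF l] by (simp add: D_def F_def mshift t_def)
    qed
    ultimately show "\<exists>h\<in>?K. h ** l \<in> D" by (rule bexI[rotated])
  next
    fix l h assume l: "l \<in> D" and h: "h \<in> ?K" and hl: "h ** l \<in> D"
    obtain z where z: "h = unip ((N *\<^sub>R z) v* m)" "\<forall>a. z $ a \<in> \<int>"
      using h by (auto simp: cubic_translations_def)
    define t where "t = m *v shift_coordinate l"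
    have lL: "l \<in> grpL" using l by (simp add: D_def)
    have "t \<in> C" "N *\<^sub>R z + t \<in> C"
      using l hl shift[OF lL] by (simp_all add: D_def F_def z(1) mshift t_def)
    then have bounds: "0 \<le> t $ a" "t $ a < N" "0 \<le> N * z $ a + t $ a" "N * z $ a + t $ a < N" for a
      by (simp_all add: C_def)
    have "z $ a = 0" for a
    proof -
      obtain k where k: "z $ a = of_int k" using z(2) by (metis Ints_cases)
      have "N * z $ a < N * 1" "N * (- 1) < N * z $ a" using bounds[of a] by linarith+
      then have "z $ a < 1" "-1 < z $ a" using N by (simp_all only: mult_less_cancel_left_pos)
      then show ?thesis using k by simp
    qed
    then have "z = 0" by (simp add: vec_eq_iff)
    then show "h ** l = l" by (simp add: z(1) unip_0)
  qed
  then show ?thesis using K.covolume_eq vol by simp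
qed

text \<open>
The conjugated cusp group \<open>H\<close> lies in \<open>L\<close> because it fixes \<open>e0\<close>, it has a fundamental domain because it
is discrete, and it contains the translations by an isometric copy of a cubic lattice. The covolume of
the latter is an integer, so \<open>covolume_rational\<close> applies.
\<close>

lemma cusp_volume_rational:
  fixes g :: "('n::finite) mat2"
  assumes haar: "haar_probability grpM \<mu>M" and v: "v \<in> primitive_cone_plus"
    and g: "g \<in> SOQ_plus" and ve: "v = e0 v* matrix_inv g"
  shows "\<exists>q\<in>\<rat>. 0 \<le> q \<and> cusp_volume \<mu>M (parabolic_of v) g = ennreal q"
proof -
  define \<Gamma> where "\<Gamma> = SOQ_plus_int \<inter> parabolic_of v"
  define H where "H = conjugate g \<Gamma>"
  have gS: "g \<in> SOQ" using g by (rule SOQ_plus_SOQ)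
  then have gp: "form_preserving g" by (simp add: SOQ_iff)
  note gg = form_preserving_inv(2,3)[OF gp]
  have fixv: "v v* \<gamma> = v" if "\<gamma> \<in> \<Gamma>" for \<gamma>
    using integral_parabolic_fixes_vector[OF v] that by (simp add: \<Gamma>_def)
  have \<Gamma>I: "\<gamma> \<in> \<Gamma>" if "\<gamma> \<in> SOQ_plus_int" "v v* \<gamma> = v" for \<gamma>
  proof -
    have "u v* \<gamma> = u" if "u \<in> ray v" for u
      using that \<open>v v* \<gamma> = v\<close> by (auto simp: ray_def scaleR_vector_matrix_assoc)
    then show ?thesis using that(1) by (simp add: \<Gamma>_def parabolic_of_def SOQ_plus_int_def)
  qed
  have \<Gamma>_pres: "form_preserving \<gamma>" "\<gamma> \<in> SOQ" if "\<gamma> \<in> \<Gamma>" for \<gamma>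
    using that SOQ_plus_SOQ by (auto simp: \<Gamma>_def SOQ_plus_int_def SOQ_iff)
  have \<Gamma>_one: "mat 1 \<in> \<Gamma>" by (intro \<Gamma>I SOQ_plus_int_mat_1) simp
  have \<Gamma>_mult: "\<gamma> ** \<delta> \<in> \<Gamma>" if "\<gamma> \<in> \<Gamma>" "\<delta> \<in> \<Gamma>" for \<gamma> \<delta>
    using that fixv by (intro \<Gamma>I SOQ_plus_int_mult) (auto simp: \<Gamma>_def vector_matrix_mul_assoc[symmetric])
  have \<Gamma>_inv: "matrix_inv \<gamma> \<in> \<Gamma>" if "\<gamma> \<in> \<Gamma>" for \<gamma>
  proof (intro \<Gamma>I SOQ_plus_int_inv)
    show "\<gamma> \<in> SOQ_plus_int" using that by (simp add: \<Gamma>_def)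
    have "(v v* \<gamma>) v* matrix_inv \<gamma> = v"
      by (simp add: vector_matrix_mul_assoc form_preserving_inv(2)[OF \<Gamma>_pres(1)[OF that]])
    then show "v v* matrix_inv \<gamma> = v" by (simp add: fixv[OF that])
  qed
  have HI: "matrix_inv g ** \<gamma> ** g \<in> H" if "\<gamma> \<in> \<Gamma>" for \<gamma>
    using that by (simp add: H_def conjugate_def)
  have conj_mult: "(matrix_inv g ** \<gamma> ** g) ** (matrix_inv g ** \<delta> ** g) = matrix_inv g ** (\<gamma> ** \<delta>) ** g" for \<gamma> \<delta>
  proof -
    have "(matrix_inv g ** \<gamma> ** g) ** (matrix_inv g ** \<delta> ** g)
        = matrix_inv g ** \<gamma> ** (g ** matrix_inv g) ** \<delta> ** g" by (simp only: matrix_mul_assoc)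
    then show ?thesis by (simp add: gg matrix_mul_assoc)
  qed
  have HL: "H \<subseteq> grpL"
  proof
    fix h assume "h \<in> H"
    then obtain \<gamma> where \<gamma>: "\<gamma> \<in> \<Gamma>" "h = matrix_inv g ** \<gamma> ** g" by (auto simp: H_def conjugate_def)
    have "e0 v* h = ((e0 v* matrix_inv g) v* \<gamma>) v* g" by (simp add: \<gamma>(2) vector_matrix_mul_assoc)
    also have "\<dots> = e0" unfolding ve[symmetric] fixv[OF \<gamma>(1)] 
      unfolding ve vector_matrix_mul_assoc gg by simp
    finally show "h \<in> grpL"
      using \<Gamma>_pres(2)[OF \<gamma>(1)] gS
      by (intro stabilizer_e0_subset_grpL) (simp_all add: \<gamma>(2) SOQ_mult SOQ_inv)
  qed
  have act: "matrix_action (haar_L \<mu>M) H"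
  proof (rule matrix_action_haar_L[OF haar HL])
    have "countable \<Gamma>"
      by (rule countable_subset[OF _ countable_integral_matrices]) (auto simp: \<Gamma>_def SOQ_plus_int_def)
    then show "countable H" by (simp add: H_def conjugate_def)
    show "mat 1 \<in> H" using HI[OF \<Gamma>_one] by (simp add: gg)
    fix h assume "h \<in> H"
    then obtain \<gamma> where \<gamma>: "\<gamma> \<in> \<Gamma>" "h = matrix_inv g ** \<gamma> ** g" by (auto simp: H_def conjugate_def)
    have "h ** (matrix_inv g ** matrix_inv \<gamma> ** g) = mat 1"
      using form_preserving_inv(2)[OF \<Gamma>_pres(1)[OF \<gamma>(1)]] by (simp add: \<gamma>(2) conj_mult gg)
    then show "matrix_inv h \<in> H" using HI[OF \<Gamma>_inv[OF \<gamma>(1)]] matrix_inv_eqI by metis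
    fix k assume "k \<in> H"
    then obtain \<delta> where \<delta>: "\<delta> \<in> \<Gamma>" "k = matrix_inv g ** \<delta> ** g" by (auto simp: H_def conjugate_def)
    show "h ** k \<in> H" using HI[OF \<Gamma>_mult[OF \<gamma>(1) \<delta>(1)]] by (simp add: \<gamma>(2) \<delta>(2) conj_mult)
  qed
  interpret H: matrix_action "haar_L \<mu>M" H by fact
  have "\<exists>D. fundamental_domain (haar_L \<mu>M) H D"
  proof (rule H.fundamental_domain_exists)
    show "sets (haar_L \<mu>M) = sets (restrict_space borel grpL)" by simp
    fix l :: "'n mat2" assume "l \<in> grpL"
    then show "\<exists>B. open B \<and> l \<in> B \<and> (\<forall>h\<in>H. \<forall>a\<in>B \<inter> grpL. h ** a \<in> B \<longrightarrow> h = mat 1)"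
      unfolding H_def by (intro conjugate_integral_wandering[OF gp]) (auto simp: \<Gamma>_def SOQ_plus_int_def)
  qed
  then obtain D where D: "fundamental_domain (haar_L \<mu>M) H D" by (elim exE)
  obtain m :: "real ^ 'n ^ 'n" and N :: nat where m: "orthogonal_matrix m" "N > 0"
    "\<And>z. (\<And>a. z $ a \<in> \<int>) \<Longrightarrow> unip ((real N *\<^sub>R z) v* m) \<in> H"
    using cusp_contains_cubic_lattice[OF v g ve] unfolding H_def \<Gamma>_def by metis
  have KH: "cubic_translations m (real N) \<subseteq> H"
    unfolding cubic_translations_def using m(3) by auto
  have K: "matrix_action (haar_L \<mu>M) (cubic_translations m (real N))"
    by (rule cubic_translations_matrix_action[OF haar KH act HL])
  have "covolume (haar_L \<mu>M) (cubic_translations m (real N)) = ennreal (real N ^ CARD('n))"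
    by (rule covolume_cubic_translations[OF haar m(1) _ K]) (use m(2) in simp)
  from H.covolume_rational[OF K KH D this]
  show ?thesis by (simp add: cusp_volume_def H_def \<Gamma>_def)
qed

theorem theorem1p1:
  fixes \<mu>M :: "('n::finite) mat2 measure"
    and \<kappa> :: nat
    and P :: "nat \<Rightarrow> 'n mat2 set"
    and v :: "nat \<Rightarrow> 'n vec2"
    and g :: "nat \<Rightarrow> 'n mat2"
  assumes "haar_probability grpM \<mu>M"
    and "bij_betw (\<lambda>i. conj_class (P i)) {1..\<kappa>} cusps"
    and "\<And>i. i \<in> {1..\<kappa>} \<Longrightarrow> v i \<in> primitive_cone_plus"
    and "\<And>i. i \<in> {1..\<kappa>} \<Longrightarrow> P i = parabolic_of (v i)"
    and "\<And>i. i \<in> {1..\<kappa>} \<Longrightarrow> g i \<in> SOQ_plus"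
    and "\<And>i. i \<in> {1..\<kappa>} \<Longrightarrow> v i = e0 v* matrix_inv (g i)"
  shows "\<forall>i\<in>{1..\<kappa>}. \<exists>q\<in>\<rat>. 0 \<le> q \<and> cusp_volume \<mu>M (P i) (g i) = ennreal q"
proof
  fix i assume i: "i \<in> {1..\<kappa>}"
  show "\<exists>q\<in>\<rat>. 0 \<le> q \<and> cusp_volume \<mu>M (P i) (g i) = ennreal q"
    unfolding assms(4)[OF i]
    by (rule cusp_volume_rational[OF assms(1) assms(3)[OF i] assms(5)[OF i] assms(6)[OF i]])
qed

end
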